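(* For every $\rho\in\mathcal P^-$ the following equalities hold: $$\overline C(\rho)=\sup_{\psi\in\mathcal A}\left\{\int\psi\,d\rho+(1-\|\rho\|)\psi_\infty\right\}=\sup_{\psi\in\mathcal B}\left\{\int\psi\,d\rho+(1-\|\rho\|)\psi_\infty\right\}.$$
   Context: Let $d\ge1$ and $N\ge 2$ be integers. $\mathcal P$ is the set of Borel probability measures on $\mathbb R^d$; $\mathcal P^-$ is the set of nonnegative Borel measures $\rho$ on $\mathbb R^d$ with total mass $\|\rho\|=\rho(\mathbb R^d)\le 1$. $\rho_n\stackrel{*}{\rightharpoonup}\rho$ denotes weak* convergence in duality with $C_0$, the continuous functions on $\mathbb R^d$ vanishing at infinity. Let $c(x_1,\dots,x_N)=\sum_{1\le i<j\le N}\frac1{|x_i-x_j|}$ for $x_i\in\mathbb R^d$ (with $1/0=+\infty$). For $\rho\in\mathcal P$, $C(\rho)=\inf\{\int c\,dP : P \text{ Borel probability on }(\mathbb R^d)^N \text{ with all } N \text{ marginals equal to } \rho\}$. For $\rho\in\mathcal P^-$, $\overline C(\rho)=\inf\{\liminf_n C(\rho_n) : \rho_n\in\mathcal P,\ \rho_n\stackrel{*}{\rightharpoonup}\rho\}$. $C_0\oplus\mathbb R$ is the set of functions $\varphi+\kappa$ with $\varphi\in C_0$, $\kappa\in\mathbb R$. $\mathcal A$ is the set of $\psi\in C_0\oplus\mathbb R$ such that $\frac1N\sum_{i=1}^N\psi(x_i)\le c(x_1,\dots,x_N)$ for all $(x_1,\dots,x_N)\in(\mathbb R^d)^N$. $\mathcal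 B$ is the set of lower semicontinuous $\psi:\mathbb R^d\to\mathbb R$ with $\inf\psi>-\infty$ satisfying the same inequality for all $(x_1,\dots,x_N)\in(\mathbb R^d)^N$. For such $\psi$, $\psi_\infty=\liminf_{|x|\to+\infty}\psi(x)$ (the limit at infinity if $\psi\in C_0\oplus\mathbb R$). *)

theory Defs
  imports "HOL-Probability.Probability"
begin

text \<open>
  The space \<open>\<real>\<^sup>d\<close> is \<open>real ^ 'd\<close> with \<open>d = CARD('d)\<close>, and \<open>N\<close>-point configurations are
  functions on the index set \<open>{..<N}\<close>, that is, points of the product measurable space
  \<open>\<Pi>\<^sub>M i\<in>{..<N}. borel\<close>. Functions that only read the coordinates \<open>i < N\<close> are defined
  on all of \<open>nat \<Rightarrow> real ^ 'd\<close>.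
\<close>

definition prob_measures :: "(real ^ 'd) measure set" where
  "prob_measures = {\<rho>. sets \<rho> = sets borel \<and> prob_space \<rho>}"

definition subprob_measures :: "(real ^ 'd) measure set" where
  "subprob_measures = {\<rho>. sets \<rho> = sets borel \<and> subprob_space \<rho>}"

definition C0 :: "(real ^ 'd \<Rightarrow> real) set" where
  "C0 = {\<phi>. continuous_on UNIV \<phi> \<and> (\<phi> \<longlongrightarrow> 0) at_infinity}"

definition weak_star_converges ::
    "(nat \<Rightarrow> (real ^ 'd) measure) \<Rightarrow> (real ^ 'd) measure \<Rightarrow> bool" where
  "weak_star_converges \<rho>s \<rho> \<longleftrightarrow>
     (\<forall>\<phi>\<in>C0. (\<lambda>n. \<integral>x. \<phi> x \<partial>\<rho>s n) \<longlonglongrightarrow> (\<integral>x. \<phi> x \<partial>\<rho>))"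

text \<open>In \<^typ>\<open>ennreal\<close>, \<open>1 / 0 = \<infinity>\<close>.\<close>

definition coulomb_cost :: "nat \<Rightarrow> (nat \<Rightarrow> real ^ 'd) \<Rightarrow> ennreal" where
  "coulomb_cost N x = (\<Sum>j<N. \<Sum>i<j. 1 / ennreal (norm (x i - x j)))"

definition transport_plans ::
    "nat \<Rightarrow> (real ^ 'd) measure \<Rightarrow> (nat \<Rightarrow> real ^ 'd) measure set" where
  "transport_plans N \<rho> =
     {P. sets P = sets (\<Pi>\<^sub>M i\<in>{..<N}. borel) \<and> prob_space P \<and>
         (\<forall>i<N. distr P borel (\<lambda>x. x i) = \<rho>)}"

definition transport_cost :: "nat \<Rightarrow> (real ^ 'd) measure \<Rightarrow> ennreal" where
  "transport_cost N \<rho> = (INF P\<in>transport_plans N \<rho>. \<integral>\<^sup>+x. coulomb_cost N x \<partial>P)"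

definition relaxed_cost :: "nat \<Rightarrow> (real ^ 'd) measure \<Rightarrow> ennreal" where
  "relaxed_cost N \<rho> =
     (INF \<rho>s\<in>{\<rho>s. (\<forall>n. \<rho>s n \<in> prob_measures) \<and> weak_star_converges \<rho>s \<rho>}.
        liminf (\<lambda>n. transport_cost N (\<rho>s n)))"

definition C0_plus_const :: "(real ^ 'd \<Rightarrow> real) set" where
  "C0_plus_const = {\<lambda>x. \<phi> x + \<kappa> | \<phi> \<kappa>. \<phi> \<in> C0}"

definition lower_semicontinuous :: "(real ^ 'd \<Rightarrow> real) \<Rightarrow> bool" where
  "lower_semicontinuous \<psi> \<longleftrightarrow> (\<forall>x. ereal (\<psi> x) \<le> Liminf (at x) (\<lambda>y. ereal (\<psi> y)))"

definition below_cost :: "nat \<Rightarrow> (real ^ 'd \<Rightarrow> real) \<Rightarrow> bool" where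
  "below_cost N \<psi> \<longleftrightarrow>
     (\<forall>x :: nat \<Rightarrow> real ^ 'd.
        ereal (1 / real N * (\<Sum>i<N. \<psi> (x i))) \<le> enn2ereal (coulomb_cost N x))"

definition class_A :: "nat \<Rightarrow> (real ^ 'd \<Rightarrow> real) set" where
  "class_A N = {\<psi>. \<psi> \<in> C0_plus_const \<and> below_cost N \<psi>}"

definition class_B :: "nat \<Rightarrow> (real ^ 'd \<Rightarrow> real) set" where
  "class_B N = {\<psi>. lower_semicontinuous \<psi> \<and> bdd_below (range \<psi>) \<and> below_cost N \<psi>}"

definition value_at_infinity :: "(real ^ 'd \<Rightarrow> real) \<Rightarrow> ereal" where
  "value_at_infinity \<psi> = Liminf at_infinity (\<lambda>x. ereal (\<psi> x))"

text \<open>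
  For \<open>N \<ge> 2\<close> every \<open>\<psi>\<close> in \<^const>\<open>class_A\<close> or \<^const>\<open>class_B\<close> is Borel and bounded: it is
  bounded below, and testing the constraint at \<open>x\<close> together with \<open>N - 1\<close> points at mutual
  distance at least 1 bounds \<open>\<psi> x\<close> above. Hence the Bochner integral below is a genuine
  integral and \<^const>\<open>value_at_infinity\<close> is finite.
\<close>

definition dual_value :: "(real ^ 'd) measure \<Rightarrow> (real ^ 'd \<Rightarrow> real) \<Rightarrow> ereal" where
  "dual_value \<rho> \<psi> =
     ereal (\<integral>x. \<psi> x \<partial>\<rho>) + ereal (1 - measure \<rho> UNIV) * value_at_infinity \<psi>"

end

theory Submission
  imports Defs
begin

text \<open>
  For \<open>\<psi> = \<phi> + \<kappa>\<close> in \<^const>\<open>class_A\<close> the dual value is \<open>\<integral>\<phi> d\<rho> + \<kappa>\<close>, which is the limit of \<open>\<integral>\<psi> d\<rho>\<^sub>n\<close>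
  along any weak* approximation by probabilities, and \<open>\<integral>\<psi> d\<rho>\<^sub>n\<close> is at most the cost of \<open>\<rho>\<^sub>n\<close>: this is
  weak duality.

  For the converse let \<open>V\<close> be the supremum over \<^const>\<open>class_A\<close>. Given finitely many \<open>\<phi>\<^sub>j\<close> in \<^const>\<open>C0\<close>,
  the vectors (averages of the \<open>\<phi>\<^sub>j\<close>, upper bound of the cost) over finitely supported probabilities
  on configurations form a convex set in a finite-dimensional space. If \<open>(\<integral>\<phi>\<^sub>j d\<rho>, V)\<close> had positive
  distance from it, a separating functional would be a combination of the \<open>\<phi>\<^sub>j\<close> and a constant
  which, tested on single configurations and rescaled, lies in \<^const>\<open>class_A\<close> and has dual value
  above \<open>V\<close>. Running through a countable dense family of test functions produces \<open>\<rho>\<^sub>n\<close> converging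
  weak* to \<open>\<rho>\<close> with cost at most \<open>V + 1/(n+1)\<close>. Neither an infinite-dimensional Hahn-Banach theorem
  nor the Riesz representation theorem is needed.

  Finally, a lower semicontinuous \<open>\<psi>\<close> in \<^const>\<open>class_B\<close> and a real \<open>m < \<psi>\<^sub>\<infinity>\<close> are approximated from
  below by \<open>m\<close> plus compactly supported truncations of the Lipschitz regularizations of \<open>\<psi> - m\<close>.
\<close>

section \<open>Continuous functions vanishing at infinity\<close>

lemma C0_bounded:
  fixes \<phi> :: "real ^ 'd \<Rightarrow> real"
  assumes "\<phi> \<in> C0"
  obtains M where "\<And>x. \<bar>\<phi> x\<bar> \<le> M"
proof -
  have "\<forall>\<^sub>F x in at_infinity. \<bar>\<phi> x\<bar> < 1"
    using assms tendstoD[of \<phi> 0 at_infinity 1] by (simp add: C0_def)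
  then obtain b where b: "\<And>x. norm x \<ge> b \<Longrightarrow> \<bar>\<phi> x\<bar> < 1"
    by (auto simp: eventually_at_infinity)
  have "bounded (\<phi> ` cball 0 b)"
    using assms by (intro compact_imp_bounded compact_continuous_image)
      (auto simp: C0_def intro: continuous_on_subset)
  then obtain B where B: "\<forall>x\<in>cball 0 b. \<bar>\<phi> x\<bar> \<le> B"
    by (auto simp: bounded_iff)
  have "\<bar>\<phi> x\<bar> \<le> max 1 B" for x
    using b[of x] B by (cases "norm x \<ge> b") (auto simp: le_max_iff_disj not_le less_imp_le)
  then show ?thesis by (rule that)
qed

lemma C0_integrable:
  assumes "\<phi> \<in> C0" "sets \<rho> = sets borel" "finite_measure \<rho>"
  shows "integrable \<rho> \<phi>"
proof -
  interpret finite_measure \<rho> by fact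
  obtain M where "\<And>x. \<bar>\<phi> x\<bar> \<le> M" using C0_bounded assms(1) by blast
  moreover have "\<phi> \<in> borel_measurable \<rho>"
    using assms(1) borel_measurable_continuous_onI[of \<phi>]
    by (simp add: C0_def measurable_cong_sets[OF assms(2) refl])
  ultimately show ?thesis by (intro integrable_const_bound[where B = M]) auto
qed

lemma C0_sum:
  assumes "\<And>i. i \<in> I \<Longrightarrow> \<phi> i \<in> C0"
  shows "(\<lambda>x. \<Sum>i\<in>I. a i * \<phi> i x) \<in> C0"
  using assms unfolding C0_def
  by (auto intro!: continuous_intros tendsto_null_sum tendsto_mult_right_zero)

lemma C0_cmult: "\<phi> \<in> C0 \<Longrightarrow> (\<lambda>x. r * \<phi> x) \<in> C0"
  unfolding C0_def by (auto intro!: continuous_intros tendsto_mult_right_zero)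

lemma C0_pos_part:
  assumes "\<phi> \<in> C0" shows "(\<lambda>x. max (\<phi> x) 0) \<in> C0"
  using assms tendsto_max[of \<phi> 0 at_infinity "\<lambda>_. 0" 0] unfolding C0_def
  by (auto intro!: continuous_intros)

text \<open>The term at infinity supplies the mass that \<open>\<rho>\<close> lacks:
  \<open>\<kappa>\<close> gets weight \<open>measure \<rho> UNIV\<close> from the integral and the
  remaining weight from the limit at infinity, so it counts in full, as for a probability.\<close>

lemma dual_value_C0_plus_const:
  fixes \<phi> :: "real ^ 'd \<Rightarrow> real"
  assumes "\<phi> \<in> C0" "\<rho> \<in> subprob_measures"
  shows "dual_value \<rho> (\<lambda>x. \<phi> x + \<kappa>) = ereal ((\<integral>x. \<phi> x \<partial>\<rho>) + \<kappa>)"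
proof -
  interpret subprob_space \<rho> using assms by (simp add: subprob_measures_def)
  have sets: "sets \<rho> = sets borel" using assms by (simp add: subprob_measures_def)
  have sp: "space \<rho> = UNIV" using sets_eq_imp_space_eq[OF sets] by simp
  have "((\<lambda>x. \<phi> x + \<kappa>) \<longlongrightarrow> 0 + \<kappa>) at_infinity"
    using assms(1) by (intro tendsto_intros) (auto simp: C0_def)
  then have "value_at_infinity (\<lambda>x. \<phi> x + \<kappa>) = ereal \<kappa>"
    unfolding value_at_infinity_def by (intro lim_imp_Liminf trivial_limit_at_infinity) auto
  moreover have "(\<integral>x. \<phi> x + \<kappa> \<partial>\<rho>) = (\<integral>x. \<phi> x \<partial>\<rho>) + \<kappa> * measure \<rho> UNIV"
    using C0_integrable[OF assms(1) sets] finite_measure_axioms sp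
    by (subst Bochner_Integration.integral_add) auto
  ultimately show ?thesis by (simp add: dual_value_def algebra_simps)
qed

subsection \<open>Separation and separability\<close>

text \<open>
  The number of test functions varies with the accuracy of the approximation, so the separation
  theorem for \<^class>\<open>euclidean_space\<close>, whose dimension is fixed by the type, does not apply.
  The separating functional is \<open>p - L\<close>, where \<open>L\<close> is the limit of a minimizing sequence for the
  distance to \<open>p\<close>, which is Cauchy by the parallelogram identity.
\<close>

lemma separation_finite_coordinates:
  fixes K :: "('i \<Rightarrow> real) set" and p :: "'i \<Rightarrow> real"
  assumes fin: "finite I" and ne: "K \<noteq> {}" and e: "e > 0"
    and conv: "\<And>u v s. u \<in> K \<Longrightarrow> v \<in> K \<Longrightarrow> 0 \<le> s \<Longrightarrow> s \<le> 1 \<Longrightarrow> (\<lambda>i. (1 - s) * u i + s * v i) \<in> K"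
    and dist: "\<And>u. u \<in> K \<Longrightarrow> e \<le> (\<Sum>i\<in>I. (u i - p i)\<^sup>2)"
  obtains a \<delta> where "\<delta> > 0" "\<And>u. u \<in> K \<Longrightarrow> (\<Sum>i\<in>I. a i * u i) \<le> (\<Sum>i\<in>I. a i * p i) - \<delta>"
proof -
  define q where "q u = (\<Sum>i\<in>I. (u i - p i)\<^sup>2)" for u
  define d where "d = Inf (q ` K)"
  have bdd: "bdd_below (q ` K)" using dist by (auto simp: q_def intro!: bdd_belowI[of _ e])
  have dle: "d \<le> q u" if "u \<in> K" for u
    unfolding d_def using bdd that by (intro cINF_lower) auto
  have "e \<le> d" unfolding d_def using ne dist by (intro cINF_greatest) (auto simp: q_def)
  with e have dpos: "d > 0" by simp
  have "\<exists>u\<in>K. q u < d + 1 / Suc m" for m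
    using cINF_less_iff[OF ne bdd, of "d + 1 / Suc m"] unfolding d_def by simp
  then obtain y where yK: "\<And>m. y m \<in> K" and yq: "\<And>m. q (y m) < d + 1 / real (Suc m)"
    by metis
  \<comment> \<open>Parallelogram identity; the midpoint is written so that it matches
    \<open>conv\<close> at \<open>s = 1/2\<close>, which bounds its \<open>q\<close> below by
    \<open>d\<close>.\<close>
  have par: "(\<Sum>i\<in>I. (u i - v i)\<^sup>2) = 2 * q u + 2 * q v - 4 * q (\<lambda>i. (1 - 1/2) * u i + 1/2 * v i)" for u v
    unfolding q_def sum_distrib_left sum.distrib[symmetric] sum_subtractf[symmetric]
    by (intro sum.cong refl) (simp add: power2_eq_square field_simps)
  have close: "(y m i - y l i)\<^sup>2 \<le> 2 / Suc m + 2 / Suc l" if "i \<in> I" for i m l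
  proof -
    have "(y m i - y l i)\<^sup>2 \<le> (\<Sum>i\<in>I. (y m i - y l i)\<^sup>2)"
      using that fin by (intro member_le_sum) auto
    also have "\<dots> \<le> 2 * q (y m) + 2 * q (y l) - 4 * d"
      unfolding par using dle[OF conv[OF yK yK, of "1/2"]] by auto
    also have "\<dots> \<le> 2 * (1 / Suc m) + 2 * (1 / Suc l)" using yq[of m] yq[of l] by linarith
    finally show ?thesis by simp
  qed
  have "\<exists>l. (\<lambda>m. y m i) \<longlonglongrightarrow> l" if "i \<in> I" for i
  proof -
    have "Cauchy (\<lambda>m. y m i)"
    proof (rule metric_CauchyI)
      fix r :: real assume r: "r > 0"
      obtain M where M: "1 / real (Suc M) < r\<^sup>2 / 4" using nat_approx_posE[of "r\<^sup>2/4"] r by auto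
      show "\<exists>M. \<forall>m\<ge>M. \<forall>n\<ge>M. dist (y m i) (y n i) < r"
      proof (intro exI allI impI)
        fix m n assume mn: "m \<ge> M" "n \<ge> M"
        have "1 / real (Suc m) \<le> 1 / real (Suc M)" "1 / real (Suc n) \<le> 1 / real (Suc M)"
          using mn by (auto intro!: divide_left_mono)
        moreover have "(y m i - y n i)\<^sup>2 \<le> 2 * (1 / Suc m) + 2 * (1 / Suc n)"
          using close[OF that, of m n] by simp
        ultimately have "(y m i - y n i)\<^sup>2 < r\<^sup>2" using M by linarith
        then have "\<bar>y m i - y n i\<bar> < r" using r abs_le_square_iff[of r "y m i - y n i"] by auto
        then show "dist (y m i) (y n i) < r" by (simp add: dist_real_def)
      qed
    qed
    then show ?thesis by (simp add: Cauchy_convergent_iff convergent_def)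
  qed
  then obtain L where L: "\<And>i. i \<in> I \<Longrightarrow> (\<lambda>m. y m i) \<longlonglongrightarrow> L i" by metis
  have "(\<lambda>m. q (y m)) \<longlonglongrightarrow> q L"
    unfolding q_def by (intro tendsto_intros L)
  moreover have "(\<lambda>m. d + 1 / real (Suc m)) \<longlonglongrightarrow> d + 0"
    by (intro tendsto_intros LIMSEQ_Suc lim_1_over_n)
  ultimately have qL: "q L \<le> d"
    using yq by (intro LIMSEQ_le[of "\<lambda>m. q (y m)" "q L" "\<lambda>m. d + 1 / real (Suc m)" d]) (auto intro: less_imp_le)
  have expand: "q (\<lambda>i. (1 - s) * L i + s * u i)
      = q L + s * (2 * (\<Sum>i\<in>I. (L i - p i) * (u i - L i)) + s * (\<Sum>i\<in>I. (u i - L i)\<^sup>2))" for s u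
    unfolding q_def sum_distrib_left sum.distrib[symmetric]
    by (intro sum.cong refl) (simp add: power2_eq_square algebra_simps)
  \<comment> \<open>\<open>L\<close> is only a limit of points of \<open>K\<close>, so minimality is
    used on the segments from \<open>y m\<close> to \<open>u\<close> and passed to the limit in
    \<open>m\<close>. Dividing by \<open>s\<close> and letting \<open>s\<close> tend to 0 leaves the
    first-order term.\<close>
  have var: "(\<Sum>i\<in>I. (L i - p i) * (u i - L i)) \<ge> 0" if u: "u \<in> K" for u
  proof -
    let ?c = "\<Sum>i\<in>I. (L i - p i) * (u i - L i)" and ?w = "\<Sum>i\<in>I. (u i - L i)\<^sup>2"
    have "0 \<le> 2 * ?c + s * ?w" if s: "0 < s" "s \<le> 1" for s
    proof -
      have "(\<lambda>m. q (\<lambda>i. (1 - s) * y m i + s * u i)) \<longlonglongrightarrow> q (\<lambda>i. (1 - s) * L i + s * u i)"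
        unfolding q_def by (intro tendsto_intros L)
      then have "d \<le> q (\<lambda>i. (1 - s) * L i + s * u i)"
        using s by (intro LIMSEQ_le_const[of _ _ d]) (auto intro!: dle conv yK u exI[of _ 0])
      then have "0 \<le> s * (2 * ?c + s * ?w)" using qL unfolding expand by linarith
      then show ?thesis using s by (simp add: zero_le_mult_iff)
    qed
    from this[of "1 / real (Suc n)" for n] have "0 \<le> 2 * ?c + (1 / Suc n) * ?w" for n by simp
    moreover have "(\<lambda>n. 2 * ?c + (1 / Suc n) * ?w) \<longlonglongrightarrow> 2 * ?c + 0 * ?w"
      by (intro tendsto_intros LIMSEQ_Suc lim_1_over_n)
    ultimately have "0 \<le> 2 * ?c + 0 * ?w" by (intro LIMSEQ_le_const) auto
    then show ?thesis by simp
  qed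
  have "(\<Sum>i\<in>I. (p i - L i) * u i) \<le> (\<Sum>i\<in>I. (p i - L i) * p i) - q L" if "u \<in> K" for u
  proof -
    have "(\<Sum>i\<in>I. (p i - L i) * p i) - q L - (\<Sum>i\<in>I. (p i - L i) * u i)
        = (\<Sum>i\<in>I. (L i - p i) * (u i - L i))"
      unfolding q_def sum_subtractf[symmetric]
      by (intro sum.cong refl) (simp add: power2_eq_square algebra_simps)
    then show ?thesis using var[OF that] by linarith
  qed
  moreover have "q L > 0"
  proof -
    have "d \<le> q L" using yK dle by (intro LIMSEQ_le_const[OF \<open>(\<lambda>m. q (y m)) \<longlonglongrightarrow> q L\<close>]) auto
    then show ?thesis using dpos by simp
  qed
  ultimately show ?thesis using that[of "q L" "\<lambda>i. p i - L i"] by blast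
qed

text \<open>
  Finite maxima of cones; those with centres in a countable dense set, rational heights and integer
  slopes form a countable family that is uniformly dense in the nonnegative part of \<^const>\<open>C0\<close>.
\<close>

fun bump_max :: "('a::metric_space \<times> real \<times> nat) list \<Rightarrow> 'a \<Rightarrow> real" where
  "bump_max [] x = 0"
| "bump_max ((a, q, k) # bs) x = max (q - real (Suc k) * dist x a) (bump_max bs x)"

lemma bump_max_nonneg: "bump_max bs x \<ge> 0"
  by (induction bs x rule: bump_max.induct) auto

lemma bump_max_ge: "(a, q, k) \<in> set bs \<Longrightarrow> q - real (Suc k) * dist x a \<le> bump_max bs x"
  by (induction bs x rule: bump_max.induct) (auto simp: le_max_iff_disj simp del: of_nat_Suc)

lemma bump_max_le:
  "(\<And>a q k. (a, q, k) \<in> set bs \<Longrightarrow> q - real (Suc k) * dist x a \<le> c) \<Longrightarrow> 0 \<le> c \<Longrightarrow> bump_max bs x \<le> c"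
  by (induction bs x rule: bump_max.induct) (auto simp del: of_nat_Suc)

lemma bump_max_C0: "bump_max bs \<in> (C0 :: (real ^ 'd \<Rightarrow> real) set)"
proof (induction bs)
  case Nil
  have "bump_max [] = (\<lambda>x :: real ^ 'd. 0)" by auto
  then show ?case by (simp add: C0_def)
next
  case (Cons b bs)
  obtain a q k where b: "b = (a, q, k)" by (cases b)
  have eq: "bump_max (b # bs) = (\<lambda>x. max (q - real (Suc k) * dist x a) (bump_max bs x))"
    by (auto simp: b)
  have "\<forall>\<^sub>F x in at_infinity. bump_max bs x = bump_max (b # bs) x"
    unfolding eventually_at_infinity
  proof (intro exI allI impI)
    \<comment> \<open>Beyond this radius \<open>dist x a\<close> is at least the absolute value of
      \<open>q\<close>, so a cone of slope at least 1 is nonpositive there.\<close>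
    fix x :: "real ^ 'd" assume "norm x \<ge> \<bar>q\<bar> + norm a"
    then have "dist x a \<ge> \<bar>q\<bar>" using norm_triangle_ineq2[of x a] by (simp add: dist_norm)
    moreover have "real (Suc k) * dist x a \<ge> 1 * dist x a" by (intro mult_right_mono) auto
    ultimately have "q - real (Suc k) * dist x a \<le> bump_max bs x"
      using bump_max_nonneg[of bs x] by linarith
    then show "bump_max bs x = bump_max (b # bs) x" by (simp add: eq max_def)
  qed
  with Cons.IH have "(bump_max (b # bs) \<longlongrightarrow> 0) at_infinity"
    unfolding C0_def by (auto elim: Lim_transform_eventually)
  moreover have "continuous_on UNIV (bump_max (b # bs))"
    unfolding eq using Cons.IH by (auto simp: C0_def simp del: of_nat_Suc intro!: continuous_intros)
  ultimately show ?case by (simp add: C0_def)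
qed

text \<open>Where \<open>\<phi>\<close> is below \<open>e\<close>, the value 0 is already accurate
  enough. The remaining set is compact and is covered by finitely many open sets on which some
  admissible cone lying below \<open>\<phi>\<close> everywhere comes within \<open>e\<close> of it;
  the maximum of these cones is the approximation.\<close>

lemma bump_max_dense:
  fixes \<phi> :: "real ^ 'd \<Rightarrow> real"
  assumes C0: "\<phi> \<in> C0" and nonneg: "\<And>x. \<phi> x \<ge> 0" and e: "e > 0"
    and D: "\<And>X. open X \<Longrightarrow> X \<noteq> {} \<Longrightarrow> \<exists>a\<in>D. a \<in> X"
  shows "\<exists>bs\<in>lists (D \<times> \<rat> \<times> UNIV). \<forall>x. \<bar>\<phi> x - bump_max bs x\<bar> \<le> e"
proof -
  have cont: "continuous_on UNIV \<phi>" using C0 by (simp add: C0_def)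
  define K where "K = {x. e \<le> \<phi> x}"
  have "\<forall>\<^sub>F x in at_infinity. \<bar>\<phi> x\<bar> < e"
    using C0 tendstoD[of \<phi> 0 at_infinity e] e by (simp add: C0_def)
  then obtain b where b: "\<And>x. norm x \<ge> b \<Longrightarrow> \<bar>\<phi> x\<bar> < e"
    by (auto simp: eventually_at_infinity)
  have "bounded K"
    unfolding bounded_iff K_def using b by (intro exI[of _ b]) (smt (verit) mem_Collect_eq)
  moreover have "closed K"
    unfolding K_def using cont by (intro closed_Collect_le continuous_intros)
  ultimately have K: "compact K" by (simp add: compact_eq_bounded_closed)
  define T where "T = {(a, q, k). a \<in> D \<and> q \<in> \<rat> \<and> (\<forall>y. q - real (Suc k) * dist y a \<le> \<phi> y)}"
  define U where "U = (\<lambda>(a, q, k). {y. \<phi> y < q - real (Suc k) * dist y a + e})"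
  have open_U: "open (U t)" for t
    unfolding U_def by (cases t) (auto intro!: open_Collect_less continuous_intros cont)
  have "K \<subseteq> (\<Union>t\<in>T. U t)"
  proof
    fix x assume x: "x \<in> K"
    \<comment> \<open>Half of the tolerance is spent on the height \<open>q\<close>, the other half
      on moving the centre from \<open>x\<close> to a point of \<open>D\<close>.\<close>
    obtain q where q: "q \<in> \<rat>" "\<phi> x - e/2 < q" "q < \<phi> x"
      using Rats_dense_in_real[of "\<phi> x - e/2" "\<phi> x"] e by auto
    have "open {y. q < \<phi> y}" using cont by (intro open_Collect_less continuous_intros)
    then obtain \<delta> where \<delta>: "\<delta> > 0" "ball x \<delta> \<subseteq> {y. q < \<phi> y}"
      using q(3) by (auto elim!: openE)
    obtain k :: nat where "q / (\<delta> / 2) < real k" using reals_Archimedean2 by blast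
    then have k: "q < real (Suc k) * (\<delta> / 2)" using \<delta>(1) by (simp add: field_simps)
    \<comment> \<open>The bound \<open>\<delta>/2\<close> leaves every point outside
      \<open>ball x \<delta>\<close> at distance at least \<open>\<delta>/2\<close> from
      \<open>a\<close>, where slope \<open>Suc k\<close> has made the cone negative. The other bound
      limits the loss at \<open>x\<close> to \<open>e/2\<close>.\<close>
    define r where "r = min (\<delta>/2) (e / (2 * real (Suc k)))"
    have "r > 0" using \<delta> e by (simp add: r_def)
    then obtain a where a: "a \<in> D" "a \<in> ball x r" using D[of "ball x r"] by auto
    have "q - real (Suc k) * dist y a \<le> \<phi> y" for y
    proof (cases "dist x y < \<delta>")
      case True
      then have "q < \<phi> y" using \<delta>(2) by auto
      moreover have "0 \<le> real (Suc k) * dist y a" by simp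
      ultimately show ?thesis by linarith
    next
      case False
      then have "\<delta>/2 \<le> dist y a"
        using a(2) dist_triangle[of x y a] by (simp add: r_def dist_commute)
      then have "real (Suc k) * (\<delta>/2) \<le> real (Suc k) * dist y a" by (intro mult_left_mono) auto
      then show ?thesis using k nonneg[of y] by linarith
    qed
    then have "(a, q, k) \<in> T" using a q by (simp add: T_def)
    moreover have "x \<in> U (a, q, k)"
    proof -
      have "dist x a \<le> e / (2 * real (Suc k))" using a(2) by (simp add: r_def)
      then have "real (Suc k) * dist x a \<le> real (Suc k) * (e / (2 * real (Suc k)))"
        by (intro mult_left_mono) auto
      also have "\<dots> = e / 2" by (simp del: of_nat_Suc)
      finally show ?thesis using q by (simp add: U_def)
    qed
    ultimately show "x \<in> (\<Union>t\<in>T. U t)" by blast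
  qed
  then obtain F where F: "F \<subseteq> T" "finite F" "K \<subseteq> (\<Union>t\<in>F. U t)"
    using compactE_image[OF K, of T U] open_U by blast
  obtain bs where bs: "set bs = F" using finite_list[OF F(2)] by blast
  have "\<bar>\<phi> x - bump_max bs x\<bar> \<le> e" for x
  proof -
    have "bump_max bs x \<le> \<phi> x"
      using F(1) bs nonneg[of x] by (intro bump_max_le) (auto simp: T_def)
    moreover have "\<phi> x \<le> bump_max bs x + e"
    proof (cases "x \<in> K")
      case True
      then obtain a q k where "(a, q, k) \<in> set bs" "x \<in> U (a, q, k)"
        using F(3) bs by auto
      then show ?thesis using bump_max_ge[of a q k bs x] by (auto simp: U_def)
    next
      case False
      then show ?thesis using bump_max_nonneg[of bs x] by (simp add: K_def)
    qed
    ultimately show ?thesis by linarith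
  qed
  moreover have "bs \<in> lists (D \<times> \<rat> \<times> UNIV)" using F(1) bs by (auto simp: T_def)
  ultimately show ?thesis by blast
qed

lemma C0_pos_separable:
  obtains \<Phi> :: "nat \<Rightarrow> real ^ 'd \<Rightarrow> real" where "\<And>j. \<Phi> j \<in> C0"
    "\<And>\<phi> e. \<phi> \<in> C0 \<Longrightarrow> (\<And>x. \<phi> x \<ge> 0) \<Longrightarrow> e > 0 \<Longrightarrow> \<exists>j. \<forall>x. \<bar>\<phi> x - \<Phi> j x\<bar> \<le> e"
proof -
  obtain D :: "(real ^ 'd) set" where D: "countable D" "\<And>X. open X \<Longrightarrow> X \<noteq> {} \<Longrightarrow> \<exists>a\<in>D. a \<in> X"
    using countable_dense_setE by blast
  let ?S = "lists (D \<times> \<rat> \<times> UNIV) :: ((real ^ 'd) \<times> real \<times> nat) list set"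
  have count: "countable ?S" using D(1) countable_rat by (intro countable_lists countable_SIGMA) auto
  have ne: "?S \<noteq> {}" by auto
  show ?thesis
  proof (rule that)
    show "bump_max (from_nat_into ?S j) \<in> C0" for j by (rule bump_max_C0)
    fix \<phi> :: "real ^ 'd \<Rightarrow> real" and e :: real
    assume "\<phi> \<in> C0" "\<And>x. \<phi> x \<ge> 0" "e > 0"
    then obtain bs where bs: "bs \<in> ?S" "\<forall>x. \<bar>\<phi> x - bump_max bs x\<bar> \<le> e"
      using bump_max_dense D(2) by blast
    then show "\<exists>j. \<forall>x. \<bar>\<phi> x - bump_max (from_nat_into ?S j) x\<bar> \<le> e"
      using from_nat_into_surj[OF count bs(1)] by metis
  qed
qed

subsection \<open>Costs and transport plans\<close>

text \<open>The sum over \<open>i < j\<close> is not visibly symmetric. Twice the cost is the sum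
  over all ordered pairs of distinct indices, which can be reindexed in each variable.\<close>

lemma coulomb_cost_permute:
  assumes \<pi>: "bij_betw \<pi> {..<N} {..<N}"
  shows "coulomb_cost N (\<lambda>i. x (\<pi> i)) = coulomb_cost N x"
proof -
  define S where "S y = (\<Sum>j<N. \<Sum>i<N. if i \<noteq> j then 1 / ennreal (norm (y i - y j)) else 0)"
    for y :: "nat \<Rightarrow> real ^ 'a"
  have twice: "2 * coulomb_cost N y = S y" for y :: "nat \<Rightarrow> real ^ 'a"
  proof -
    let ?k = "\<lambda>i j. 1 / ennreal (norm (y i - y j))"
    have c: "coulomb_cost N y = (\<Sum>j<N. \<Sum>i<N. if i < j then ?k i j else 0)"
      unfolding coulomb_cost_def
      by (intro sum.cong refl sum.mono_neutral_cong_left) auto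
    also have "\<dots> = (\<Sum>j<N. \<Sum>i<N. if j < i then ?k i j else 0)"
      by (subst sum.swap) (intro sum.cong refl, simp add: norm_minus_commute)
    finally have c': "coulomb_cost N y = (\<Sum>j<N. \<Sum>i<N. if j < i then ?k i j else 0)" .
    have "2 * coulomb_cost N y = coulomb_cost N y + coulomb_cost N y" by (rule mult_2)
    also have "\<dots> = (\<Sum>j<N. \<Sum>i<N. if i < j then ?k i j else 0) + (\<Sum>j<N. \<Sum>i<N. if j < i then ?k i j else 0)"
      using c c' by simp
    also have "\<dots> = S y"
      unfolding S_def sum.distrib[symmetric] by (intro sum.cong refl) auto
    finally show ?thesis .
  qed
  have "S (\<lambda>i. x (\<pi> i)) = (\<Sum>j<N. \<Sum>i<N. if \<pi> i \<noteq> \<pi> j then 1 / ennreal (norm (x (\<pi> i) - x (\<pi> j))) else 0)"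
    unfolding S_def using bij_betw_imp_inj_on[OF \<pi>] by (intro sum.cong refl) (auto simp: inj_on_eq_iff)
  also have "\<dots> = (\<Sum>j<N. \<Sum>i<N. if i \<noteq> \<pi> j then 1 / ennreal (norm (x i - x (\<pi> j))) else 0)"
    by (intro sum.cong refl sum.reindex_bij_betw[OF \<pi>])
  also have "\<dots> = S x"
    unfolding S_def by (rule sum.reindex_bij_betw[OF \<pi>])
  finally have "2 * coulomb_cost N (\<lambda>i. x (\<pi> i)) = 2 * coulomb_cost N x" by (simp add: twice)
  then show ?thesis by (simp add: ennreal_mult_cancel_left)
qed

lemma coulomb_cost_cong: "(\<And>i. i < N \<Longrightarrow> x i = y i) \<Longrightarrow> coulomb_cost N x = coulomb_cost N y"
  unfolding coulomb_cost_def by (intro sum.cong refl) auto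

lemma coulomb_cost_finite:
  "inj_on x {..<N} \<Longrightarrow> coulomb_cost N x < \<top>"
  unfolding coulomb_cost_def
  by (auto simp: inj_on_def less_top[symmetric] ennreal_divide_eq_top_iff)

lemma coulomb_cost_translate: "coulomb_cost N (\<lambda>i. a + x i) = coulomb_cost N x"
  unfolding coulomb_cost_def by simp

section \<open>Plans built from discrete distributions on configurations\<close>

lemma bij_betw_add_mod:
  fixes k N :: nat
  shows "bij_betw (\<lambda>s. (k + s) mod N) {..<N} {..<N}"
proof (cases "N = 0")
  case False
  have "s \<le> t" if "(k + s) mod N = (k + t) mod N" "s < N" for s t
  proof (rule ccontr)
    assume "\<not> s \<le> t"
    with that(1) have "N dvd s - t" using mod_eq_dvd_iff_nat[of "k + t" "k + s" N] by simp
    with \<open>\<not> s \<le> t\<close> have "N \<le> s - t" by (intro dvd_imp_le) auto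
    with that(2) \<open>\<not> s \<le> t\<close> show False by simp
  qed
  then have "inj_on (\<lambda>s. (k + s) mod N) {..<N}" by (intro inj_onI antisym) (auto intro: sym)
  moreover have "(\<lambda>s. (k + s) mod N) ` {..<N} \<subseteq> {..<N}" using False by auto
  ultimately show ?thesis
    using endo_inj_surj[of "{..<N}"] by (auto simp: bij_betw_def)
qed (auto simp: bij_betw_def)

text \<open>The average of the \<open>N\<close> coordinate laws of \<open>p\<close>, encoded as the
  law of a uniformly chosen coordinate. The outer \<open>distr\<close> replaces the discrete
  sigma-algebra of a pmf by the Borel one.\<close>

definition config_marginal :: "nat \<Rightarrow> (nat \<Rightarrow> real ^ 'd) pmf \<Rightarrow> (real ^ 'd) measure" where
  "config_marginal N p = distr (measure_pmf (map_pmf (\<lambda>(x, i). x i) (pair_pmf p (pmf_of_set {..<N})))) borel (\<lambda>y. y)"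

lemma config_marginal_prob: "config_marginal N p \<in> prob_measures"
  unfolding config_marginal_def prob_measures_def
  by (auto intro!: measure_pmf.prob_space_distr)

lemma integral_config_marginal:
  assumes "finite (set_pmf p)" "N > 0" "\<phi> \<in> borel_measurable borel"
  shows "(\<integral>y. \<phi> y \<partial>config_marginal N p) = measure_pmf.expectation p (\<lambda>x. 1 / real N * (\<Sum>i<N. \<phi> (x i)))"
proof -
  have ne: "{..<N} \<noteq> {}" using assms(2) by auto
  have "(\<integral>y. \<phi> y \<partial>config_marginal N p)
      = measure_pmf.expectation (pair_pmf p (pmf_of_set {..<N})) (\<lambda>(x, i). \<phi> (x i))"
    unfolding config_marginal_def using assms
    by (subst integral_distr) (auto simp: case_prod_unfold)
  also have "\<dots> = (\<Sum>(x, i)\<in>set_pmf p \<times> {..<N}. pmf p x * (1 / real N) * \<phi> (x i))"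
    using assms by (subst integral_measure_pmf[where A = "set_pmf p \<times> {..<N}"])
      (auto simp: pmf_pair case_prod_unfold pmf_of_set[OF ne] set_pmf_of_set[OF ne] intro!: sum.cong)
  also have "\<dots> = (\<Sum>x\<in>set_pmf p. pmf p x * (1 / real N * (\<Sum>i<N. \<phi> (x i))))"
    unfolding sum.cartesian_product[symmetric] by (simp add: sum_distrib_left mult.assoc)
  also have "\<dots> = measure_pmf.expectation p (\<lambda>x. 1 / real N * (\<Sum>i<N. \<phi> (x i)))"
    using assms by (subst integral_measure_pmf[where A = "set_pmf p"]) auto
  finally show ?thesis .
qed

text \<open>
  All marginals of a plan must agree; averaging a configuration over its \<open>N\<close> cyclic shifts
  achieves this and, the cost being symmetric, does not change the cost.
\<close>

lemma transport_cost_config_marginal: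
  assumes "N > 0"
  shows "transport_cost N (config_marginal N p) \<le> (\<integral>\<^sup>+x. coulomb_cost N x \<partial>measure_pmf p)"
proof -
  let ?U = "pmf_of_set {..<N}"
  \<comment> \<open>Points of the product space are extensional, hence \<open>undefined\<close>
    outside \<open>{..<N}\<close>.\<close>
  let ?r = "\<lambda>(x, s) i. if i < N then x ((i + s) mod N) else undefined"
  define P where "P = distr (measure_pmf (pair_pmf p ?U)) (\<Pi>\<^sub>M i\<in>{..<N}. (borel :: (real ^ 'a) measure)) ?r"
  have meas: "?r \<in> measurable (measure_pmf (pair_pmf p ?U)) (\<Pi>\<^sub>M i\<in>{..<N}. (borel :: (real ^ 'a) measure))"
    by (auto simp: space_PiM PiE_def extensional_def)
  have "distr P borel (\<lambda>x. x i) = config_marginal N p" if i: "i < N" for i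
  proof -
    have "distr P borel (\<lambda>x. x i)
        = distr (measure_pmf (pair_pmf p ?U)) borel (\<lambda>(x, s). x ((i + s) mod N))"
      unfolding P_def using i meas
      by (subst distr_distr) (auto intro!: arg_cong[of _ _ "distr _ _"] simp: fun_eq_iff)
    also have "\<dots> = distr (measure_pmf (map_pmf (\<lambda>(x, s). x ((i + s) mod N)) (pair_pmf p ?U))) borel (\<lambda>y. y)"
      unfolding map_pmf_rep_eq by (subst distr_distr) (auto simp: comp_def)
    \<comment> \<open>A uniform index shifted by \<open>i\<close> modulo \<open>N\<close> is again
      uniform, so the law of coordinate \<open>i\<close> does not depend on
      \<open>i\<close>.\<close>
    also have "map_pmf (\<lambda>(x, s). x ((i + s) mod N)) (pair_pmf p ?U)
        = map_pmf (\<lambda>(x, j). x j) (pair_pmf p (map_pmf (\<lambda>s. (i + s) mod N) ?U))"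
      by (simp add: pair_map_pmf2 map_pmf_comp case_prod_unfold)
    also have "map_pmf (\<lambda>s. (i + s) mod N) ?U = ?U"
      using assms by (intro map_pmf_of_set_bij_betw bij_betw_add_mod) auto
    finally show ?thesis by (simp add: config_marginal_def)
  qed
  moreover have "prob_space P" unfolding P_def by (rule measure_pmf.prob_space_distr[OF meas])
  ultimately have "P \<in> transport_plans N (config_marginal N p)"
    by (auto simp: transport_plans_def P_def)
  then have "transport_cost N (config_marginal N p) \<le> (\<integral>\<^sup>+x. coulomb_cost N x \<partial>P)"
    unfolding transport_cost_def by (rule INF_lower)
  also have "\<dots> = (\<integral>\<^sup>+z. coulomb_cost N (?r z) \<partial>measure_pmf (pair_pmf p ?U))"
    unfolding P_def by (rule nn_integral_distr[OF meas]) (auto simp: coulomb_cost_def)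
  also have "\<dots> = (\<integral>\<^sup>+(x, s). coulomb_cost N x \<partial>measure_pmf (pair_pmf p ?U))"
  proof (intro nn_integral_cong, clarsimp)
    fix x :: "nat \<Rightarrow> real ^ 'a" and s
    have "coulomb_cost N (\<lambda>i. if i < N then x ((i + s) mod N) else undefined)
      = coulomb_cost N (\<lambda>i. x ((s + i) mod N))"
      by (intro coulomb_cost_cong) (auto simp: add.commute)
    then show "coulomb_cost N (\<lambda>i. if i < N then x ((i + s) mod N) else undefined) = coulomb_cost N x"
      using coulomb_cost_permute[OF bij_betw_add_mod] by simp
  qed
  also have "\<dots> = (\<integral>\<^sup>+x. coulomb_cost N x \<partial>measure_pmf p)"
    by (simp add: nn_integral_pair_pmf')
  finally show ?thesis .
qed

text \<open>Serves the convexity of \<open>K\<close> in \<open>weak_star_approximation\<close>. A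
  coin of bias \<open>s\<close> decides whether to sample from \<open>q\<close> or from
  \<open>p\<close>.\<close>

lemma finite_pmf_mixture:
  fixes p q :: "'a pmf"
  assumes fin: "finite (set_pmf p)" "finite (set_pmf q)" and s: "0 \<le> s" "s \<le> 1"
  obtains r where "set_pmf r \<subseteq> set_pmf p \<union> set_pmf q"
    "\<And>f :: 'a \<Rightarrow> real. measure_pmf.expectation r f
       = (1 - s) * measure_pmf.expectation p f + s * measure_pmf.expectation q f"
proof
  let ?r = "bind_pmf (bernoulli_pmf s) (\<lambda>b. if b then q else p)"
  show sub: "set_pmf ?r \<subseteq> set_pmf p \<union> set_pmf q" by (auto split: if_splits)
  let ?A = "set_pmf p \<union> set_pmf q"
  have pmf: "pmf ?r a = (1 - s) * pmf p a + s * pmf q a" for a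
    using s by (simp add: pmf_bind)
  fix f :: "'a \<Rightarrow> real"
  have E: "measure_pmf.expectation M f = (\<Sum>a\<in>?A. pmf M a * f a)" if "set_pmf M \<subseteq> ?A" for M
    using fin that by (subst integral_measure_pmf[where A = ?A]) auto
  show "measure_pmf.expectation ?r f
       = (1 - s) * measure_pmf.expectation p f + s * measure_pmf.expectation q f"
    unfolding E[OF sub] E[of p, simplified] E[of q, simplified] pmf sum_distrib_left sum.distrib[symmetric]
    by (intro sum.cong refl) (simp add: algebra_simps)
qed

section \<open>Weak duality\<close>

lemma transport_cost_ge:
  assumes below: "below_cost N \<psi>" and N: "N > 0" and meas: "\<psi> \<in> borel_measurable borel"
    and bound: "\<And>x. \<bar>\<psi> x\<bar> \<le> M" and \<mu>: "\<mu> \<in> prob_measures"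
  shows "ennreal (\<integral>x. \<psi> x \<partial>\<mu>) \<le> transport_cost N \<mu>"
  unfolding transport_cost_def
proof (rule INF_greatest)
  fix P assume P: "P \<in> transport_plans N \<mu>"
  then interpret prob_space P by (simp add: transport_plans_def)
  have coord: "(\<lambda>x. x i) \<in> measurable P borel" if "i < N" for i
    using P that by (auto simp: transport_plans_def cong: measurable_cong_sets)
  have mi: "(\<lambda>x. \<psi> (x i)) \<in> borel_measurable P" if "i < N" for i
    using measurable_compose[OF coord meas] that by simp
  have int: "integrable P (\<lambda>x. \<psi> (x i))" if "i < N" for i
    using mi that bound by (intro integrable_const_bound[where B = M]) auto
  have eq: "(\<integral>x. \<psi> (x i) \<partial>P) = (\<integral>x. \<psi> x \<partial>\<mu>)" if "i < N" for i
    using P that integral_distr[OF coord meas, of i] by (auto simp: transport_plans_def)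
  let ?f = "\<lambda>x. 1 / real N * (\<Sum>i<N. \<psi> (x i))"
  have intf: "integrable P ?f" using int by (intro integrable_mult_right integrable_sum) auto
  \<comment> \<open>Every marginal of \<open>P\<close> is \<open>\<mu>\<close>, so each summand of
    \<open>?f\<close> integrates to the same number.\<close>
  have "(\<integral>x. \<psi> x \<partial>\<mu>) = (\<integral>x. ?f x \<partial>P)"
    using int eq N by (simp add: integral_sum)
  \<comment> \<open>The comparison with the cost takes place in \<open>ennreal\<close>, so only the
    positive part of \<open>?f\<close> is kept; it still lies below the nonnegative cost.\<close>
  also have "\<dots> \<le> (\<integral>x. max (?f x) 0 \<partial>P)"
    using intf by (intro integral_mono) auto
  finally have "ennreal (\<integral>x. \<psi> x \<partial>\<mu>) \<le> ennreal (\<integral>x. max (?f x) 0 \<partial>P)" by (rule ennreal_leI)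
  also have "\<dots> = (\<integral>\<^sup>+x. ennreal (max (?f x) 0) \<partial>P)"
    using intf by (intro nn_integral_eq_integral[symmetric]) auto
  also have "\<dots> \<le> (\<integral>\<^sup>+x. coulomb_cost N x \<partial>P)"
  proof (rule nn_integral_mono)
    fix x
    have "ereal (?f x) \<le> enn2ereal (coulomb_cost N x)" using below by (simp add: below_cost_def)
    then have "e2ennreal (ereal (?f x)) \<le> coulomb_cost N x"
      using e2ennreal_mono by fastforce
    then show "ennreal (max (?f x) 0) \<le> coulomb_cost N x"
      by (simp add: max_def ennreal_neg split: if_splits)
  qed
  finally show "ennreal (\<integral>x. \<psi> x \<partial>\<mu>) \<le> (\<integral>\<^sup>+x. coulomb_cost N x \<partial>P)" .
qed

lemma weak_duality:
  assumes N: "N > 0" and \<rho>: "\<rho> \<in> subprob_measures" and \<psi>: "\<psi> \<in> class_A N"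
  shows "dual_value \<rho> \<psi> \<le> enn2ereal (relaxed_cost N \<rho>)"
proof -
  from \<psi> obtain \<phi> \<kappa> where \<phi>: "\<phi> \<in> C0" "\<psi> = (\<lambda>x. \<phi> x + \<kappa>)" and below: "below_cost N \<psi>"
    by (auto simp: class_A_def C0_plus_const_def)
  let ?v = "(\<integral>x. \<phi> x \<partial>\<rho>) + \<kappa>"
  obtain M where M: "\<And>x. \<bar>\<phi> x\<bar> \<le> M" using C0_bounded \<phi>(1) by blast
  have meas: "\<psi> \<in> borel_measurable borel"
    using \<phi> borel_measurable_continuous_onI[of \<phi>] by (simp add: C0_def)
  have "ennreal ?v \<le> relaxed_cost N \<rho>"
    unfolding relaxed_cost_def
  proof (rule INF_greatest, clarsimp)
    fix \<rho>s :: "nat \<Rightarrow> _" assume p: "\<forall>n. \<rho>s n \<in> prob_measures" and w: "weak_star_converges \<rho>s \<rho>"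
    have eq: "(\<integral>x. \<psi> x \<partial>\<rho>s n) = (\<integral>x. \<phi> x \<partial>\<rho>s n) + \<kappa>" for n
    proof -
      interpret prob_space "\<rho>s n" using p by (simp add: prob_measures_def)
      have "integrable (\<rho>s n) \<phi>"
        using p \<phi>(1) finite_measure_axioms by (intro C0_integrable) (auto simp: prob_measures_def)
      then show ?thesis unfolding \<phi>(2) using prob_space by (subst Bochner_Integration.integral_add) auto
    qed
    have "(\<lambda>n. ennreal (\<integral>x. \<psi> x \<partial>\<rho>s n)) \<longlonglongrightarrow> ennreal ?v"
      unfolding eq using w \<phi>(1) by (intro tendsto_ennrealI tendsto_intros) (auto simp: weak_star_converges_def)
    then have "ennreal ?v = liminf (\<lambda>n. ennreal (\<integral>x. \<psi> x \<partial>\<rho>s n))"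
      by (simp add: lim_imp_Liminf)
    also have "\<dots> \<le> liminf (\<lambda>n. transport_cost N (\<rho>s n))"
    proof (intro Liminf_mono always_eventually allI transport_cost_ge[OF below N meas])
      show "\<bar>\<psi> x\<bar> \<le> M + \<bar>\<kappa>\<bar>" for x using M[of x] \<phi>(2) by auto
    qed (use p in auto)
    finally show "ennreal ?v \<le> liminf (\<lambda>n. transport_cost N (\<rho>s n))" .
  qed
  then have "enn2ereal (ennreal ?v) \<le> enn2ereal (relaxed_cost N \<rho>)" by (simp add: less_eq_ennreal.rep_eq)
  \<comment> \<open>\<open>ennreal\<close> sends negative reals to 0, hence an inequality rather
    than an equality.\<close>
  moreover have "ereal ?v \<le> enn2ereal (ennreal ?v)"
    by (cases "?v \<ge> 0") (auto simp: enn2ereal_ennreal ennreal_neg zero_ennreal.rep_eq)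
  ultimately show ?thesis using dual_value_C0_plus_const[OF \<phi>(1) \<rho>] \<phi>(2) by simp
qed

text \<open>At infinite cost the constraint is void. This matches the separation argument, which
  tests only configurations of finite cost.\<close>

lemma below_cost_finite:
  assumes "\<And>x :: nat \<Rightarrow> real ^ 'd. coulomb_cost N x < \<top> \<Longrightarrow>
    1 / real N * (\<Sum>i<N. \<psi> (x i)) \<le> enn2real (coulomb_cost N x)"
  shows "below_cost N \<psi>"
  unfolding below_cost_def
proof
  fix x :: "nat \<Rightarrow> real ^ 'd"
  show "ereal (1 / real N * (\<Sum>i<N. \<psi> (x i))) \<le> enn2ereal (coulomb_cost N x)"
  proof (cases "coulomb_cost N x < \<top>")
    case True
    then have "enn2ereal (coulomb_cost N x) = ereal (enn2real (coulomb_cost N x))"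
      by (cases "coulomb_cost N x") (auto simp: enn2ereal_ennreal)
    then show ?thesis using assms[OF True] by simp
  next
    case False
    then have "coulomb_cost N x = \<top>" by (simp add: not_less top_unique)
    then show ?thesis by simp
  qed
qed

subsection \<open>Duality for \<open>class_A\<close>\<close>

text \<open>Equally spaced points on a line are distinct. Starting at the origin lets a translate of
  the configuration place its first point anywhere, as \<open>below_cost_bounded\<close>
  does.\<close>

lemma ex_finite_cost_config:
  obtains x0 :: "nat \<Rightarrow> real ^ 'd" where "coulomb_cost N x0 < \<top>" "x0 0 = 0"
proof -
  obtain e :: "real ^ 'd" where "norm e = 1" using vector_choose_size[of 1] by auto
  then have "inj_on (\<lambda>i. real i *\<^sub>R e) {..<N}" by (auto intro!: inj_onI)
  from that[OF coulomb_cost_finite[OF this]] show ?thesis by simp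
qed

lemma class_A_I:
  "\<phi> \<in> C0 \<Longrightarrow> below_cost N (\<lambda>x. \<phi> x + \<kappa>) \<Longrightarrow> (\<lambda>x. \<phi> x + \<kappa>) \<in> class_A N"
  unfolding class_A_def C0_plus_const_def by blast

lemma weak_star_approximation:
  fixes \<phi> :: "nat \<Rightarrow> real ^ 'd \<Rightarrow> real"
  assumes N: "N > 0" and \<rho>: "\<rho> \<in> subprob_measures" and \<phi>: "\<And>j. \<phi> j \<in> C0"
    and V: "V \<ge> 0" and dual: "\<And>\<psi>. \<psi> \<in> class_A N \<Longrightarrow> dual_value \<rho> \<psi> \<le> ereal V" and e: "e > 0"
  obtains \<mu> where "\<mu> \<in> prob_measures" "\<And>j. j < n \<Longrightarrow> \<bar>(\<integral>x. \<phi> j x \<partial>\<mu>) - (\<integral>x. \<phi> j x \<partial>\<rho>)\<bar> < e"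
    "transport_cost N \<mu> \<le> ennreal (V + e)"
proof -
  define avg where "avg j x = 1 / real N * (\<Sum>i<N. \<phi> j (x i))" for j and x :: "nat \<Rightarrow> real ^ 'd"
  define cr where "cr x = enn2real (coulomb_cost N x)" for x :: "nat \<Rightarrow> real ^ 'd"
  define R where "R = {p :: (nat \<Rightarrow> real ^ 'd) pmf. finite (set_pmf p) \<and> (\<forall>x\<in>set_pmf p. coulomb_cost N x < \<top>)}"
  \<comment> \<open>The last coordinate may exceed the cost, so a separating functional has \<open>a n \<le> 0\<close>.\<close>
  define K where "K = {u :: nat \<Rightarrow> real. \<exists>p\<in>R. (\<forall>j<n. u j = measure_pmf.expectation p (avg j)) \<and>
    measure_pmf.expectation p cr \<le> u n}"
  define t where "t j = (if j < n then \<integral>x. \<phi> j x \<partial>\<rho> else V)" for j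
  have KI: "u \<in> K" if "p \<in> R" "\<And>j. j < n \<Longrightarrow> u j = measure_pmf.expectation p (avg j)"
    "measure_pmf.expectation p cr \<le> u n" for p u
    unfolding K_def using that by blast
  have return_R: "return_pmf x \<in> R" if "coulomb_cost N x < \<top>" for x
    using that by (simp add: R_def)
  have conv: "(\<lambda>i. (1 - s) * u i + s * v i) \<in> K" if "u \<in> K" "v \<in> K" and s: "0 \<le> s" "s \<le> 1" for u v s
  proof -
    obtain p where p: "p \<in> R" "\<And>j. j < n \<Longrightarrow> u j = measure_pmf.expectation p (avg j)"
      "measure_pmf.expectation p cr \<le> u n" using \<open>u \<in> K\<close> by (auto simp: K_def)
    obtain q where q: "q \<in> R" "\<And>j. j < n \<Longrightarrow> v j = measure_pmf.expectation q (avg j)"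
      "measure_pmf.expectation q cr \<le> v n" using \<open>v \<in> K\<close> by (auto simp: K_def)
    have fin: "finite (set_pmf p)" "finite (set_pmf q)" using p q by (auto simp: R_def)
    obtain r where r: "set_pmf r \<subseteq> set_pmf p \<union> set_pmf q"
      "\<And>f :: _ \<Rightarrow> real. measure_pmf.expectation r f
         = (1 - s) * measure_pmf.expectation p f + s * measure_pmf.expectation q f"
      by (rule finite_pmf_mixture[OF fin s]) (rule that)
    have "r \<in> R" using p(1) q(1) r(1) by (auto simp: R_def intro: finite_subset)
    moreover have "(1 - s) * measure_pmf.expectation p cr + s * measure_pmf.expectation q cr
        \<le> (1 - s) * u n + s * v n"
      using p q s by (intro add_mono mult_left_mono) auto
    ultimately show ?thesis using p(2) q(2) by (intro KI[of r]) (simp_all add: r(2))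
  qed
  obtain x0 :: "nat \<Rightarrow> real ^ 'd" where "coulomb_cost N x0 < \<top>" using ex_finite_cost_config .
  then have "(\<lambda>j. if j < n then avg j x0 else cr x0) \<in> K"
    by (intro KI[OF return_R]) auto
  then have ne: "K \<noteq> {}" by auto
  \<comment> \<open>Euclidean closeness to \<open>t\<close> controls the first \<open>n\<close>
    moments and, in coordinate \<open>n\<close>, the excess of the cost over
    \<open>V\<close>.\<close>
  have "\<exists>u\<in>K. (\<Sum>j\<le>n. (u j - t j)\<^sup>2) < e\<^sup>2"
  proof (rule ccontr)
    assume "\<not> ?thesis"
    then have far: "e\<^sup>2 \<le> (\<Sum>j\<le>n. (u j - t j)\<^sup>2)" if "u \<in> K" for u using that by (auto simp: not_less)
    have "e\<^sup>2 > 0" using e by simp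
    obtain a \<delta> where \<delta>: "\<delta> > 0"
      and sep: "\<And>u. u \<in> K \<Longrightarrow> (\<Sum>j\<le>n. a j * u j) \<le> (\<Sum>j\<le>n. a j * t j) - \<delta>"
    proof (rule separation_finite_coordinates[OF finite_atMost ne \<open>e\<^sup>2 > 0\<close> conv far])
      fix a \<delta> assume "\<delta> > 0" "\<And>u. u \<in> K \<Longrightarrow> (\<Sum>j\<le>n. a j * u j) \<le> (\<Sum>j\<le>n. a j * t j) - \<delta>"
      then show thesis by (rule that)
    qed
    define \<beta> where "\<beta> = (\<Sum>j\<le>n. a j * t j) - \<delta>"
    \<comment> \<open>The separating inequality at a point mass, with any \<open>s\<close> above the
      cost in the last coordinate.\<close>
    have sep': "(\<Sum>j<n. a j * avg j x) + a n * s \<le> \<beta>" if "coulomb_cost N x < \<top>" "cr x \<le> s" for x s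
    proof -
      have "(\<lambda>j. if j < n then avg j x else s) \<in> K"
        using that by (intro KI[OF return_R]) auto
      from sep[OF this] show ?thesis by (simp add: \<beta>_def lessThan_Suc_atMost[symmetric])
    qed
    have an: "a n \<le> 0"
    proof (rule ccontr)
      assume pos: "\<not> a n \<le> 0"
      let ?w = "\<beta> - (\<Sum>j<n. a j * avg j x0)"
      \<comment> \<open>Large enough that \<open>a n * ?s\<close> would be at least
        \<open>?w + 1\<close>.\<close>
      let ?s = "max (cr x0) ((?w + 1) / a n)"
      have "a n * ?s \<le> ?w" using sep'[OF \<open>coulomb_cost N x0 < \<top>\<close>, of ?s] by simp
      moreover have "a n * ((?w + 1) / a n) \<le> a n * ?s" using pos by (intro mult_left_mono) auto
      ultimately show False using pos by simp
    qed
    \<comment> \<open>If \<open>a n < 0\<close> the choice \<open>\<gamma> = 1 / - a n\<close> contradicts the bound \<open>V\<close>; if \<open>a n = 0\<close> every \<open>\<gamma> \<ge> 0\<close>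
      is admissible and a large one does.\<close>
    have bound: "\<gamma> * (\<delta> - a n * V) \<le> V" if "\<gamma> \<ge> 0" "\<gamma> * (- a n) \<le> 1" for \<gamma>
    proof -
      define \<psi>0 where "\<psi>0 = (\<lambda>x. \<Sum>j<n. (\<gamma> * a j) * \<phi> j x)"
      \<comment> \<open>Subtracting \<open>\<gamma> * \<beta>\<close> turns \<open>sep'\<close> into
        the bound \<open>\<gamma> * (- a n)\<close> times the cost, which the choice of
        \<open>\<gamma>\<close> keeps below the cost itself.\<close>
      define \<psi> where "\<psi> = (\<lambda>x. \<psi>0 x + (- \<gamma> * \<beta>))"
      have "below_cost N \<psi>"
      proof (rule below_cost_finite)
        fix x :: "nat \<Rightarrow> real ^ 'd" assume fin: "coulomb_cost N x < \<top>"
        have "(\<Sum>i<N. \<psi>0 (x i)) = (\<Sum>j<n. \<gamma> * a j * (\<Sum>i<N. \<phi> j (x i)))"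
          unfolding \<psi>0_def by (subst sum.swap) (simp add: sum_distrib_left)
        moreover have "(\<Sum>i<N. \<psi> (x i)) = (\<Sum>i<N. \<psi>0 (x i)) - real N * (\<gamma> * \<beta>)"
          by (simp add: \<psi>_def sum_subtractf)
        moreover have "\<gamma> * (\<Sum>j<n. a j * avg j x) = 1 / real N * (\<Sum>j<n. \<gamma> * a j * (\<Sum>i<N. \<phi> j (x i)))"
          unfolding avg_def sum_distrib_left[of _ _ "{..<n}"] by (intro sum.cong refl) simp
        ultimately have "1 / real N * (\<Sum>i<N. \<psi> (x i)) = \<gamma> * ((\<Sum>j<n. a j * avg j x) - \<beta>)"
          using N by (simp add: right_diff_distrib)
        also have "\<dots> \<le> \<gamma> * (- a n * cr x)"
          using sep'[OF fin order_refl] that(1) by (intro mult_left_mono) auto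
        also have "\<dots> = (\<gamma> * - a n) * cr x" by simp
        also have "\<dots> \<le> 1 * cr x" using that(2) by (intro mult_right_mono) (auto simp: cr_def)
        finally show "1 / real N * (\<Sum>i<N. \<psi> (x i)) \<le> enn2real (coulomb_cost N x)"
          by (simp add: cr_def)
      qed
      moreover have \<psi>0: "\<psi>0 \<in> C0" unfolding \<psi>0_def using \<phi> by (intro C0_sum)
      ultimately have "\<psi> \<in> class_A N" unfolding \<psi>_def by (intro class_A_I)
      then have "(\<integral>x. \<psi>0 x \<partial>\<rho>) + (- \<gamma> * \<beta>) \<le> V"
        using dual[of \<psi>] dual_value_C0_plus_const[OF \<psi>0 \<rho>, of "- \<gamma> * \<beta>"] by (simp add: \<psi>_def)
      moreover have "(\<integral>x. \<psi>0 x \<partial>\<rho>) = \<gamma> * (\<Sum>j<n. a j * t j)"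
      proof -
        have "integrable \<rho> (\<phi> j)" for j
          using \<rho> \<phi> by (intro C0_integrable) (auto simp: subprob_measures_def subprob_space_def)
        then have "(\<integral>x. \<psi>0 x \<partial>\<rho>) = (\<Sum>j<n. (\<gamma> * a j) * t j)"
          unfolding \<psi>0_def t_def by (subst Bochner_Integration.integral_sum) auto
        then show ?thesis by (simp add: sum_distrib_left mult.assoc)
      qed
      moreover have "\<beta> = (\<Sum>j<n. a j * t j) + a n * V - \<delta>"
        by (simp add: \<beta>_def t_def lessThan_Suc_atMost[symmetric])
      ultimately show ?thesis by (simp add: algebra_simps)
    qed
    show False
    proof (cases "a n = 0")
      case True
      then show False using bound[of "(V + 1) / \<delta>"] \<delta> V by simp
    next
      case False
      then have neg: "a n < 0" using an by simp
      have "(1 / - a n) * (\<delta> - a n * V) = V + \<delta> / - a n" using neg by (simp add: field_simps)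
      moreover have "\<delta> / - a n > 0" using neg \<delta> by (intro divide_pos_pos) auto
      ultimately show False using bound[of "1 / - a n"] neg by simp
    qed
  qed
  then obtain u where u: "u \<in> K" "(\<Sum>j\<le>n. (u j - t j)\<^sup>2) < e\<^sup>2" by blast
  have coord: "\<bar>u j - t j\<bar> < e" if "j \<le> n" for j
  proof -
    have "(u j - t j)\<^sup>2 \<le> (\<Sum>j\<le>n. (u j - t j)\<^sup>2)" using that by (intro member_le_sum) auto
    then show ?thesis using u(2) e abs_le_square_iff[of e "u j - t j"] by auto
  qed
  obtain p where p: "finite (set_pmf p)" "\<And>x. x \<in> set_pmf p \<Longrightarrow> coulomb_cost N x < \<top>"
    "\<And>j. j < n \<Longrightarrow> u j = measure_pmf.expectation p (avg j)" "measure_pmf.expectation p cr \<le> u n"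
    using u(1) by (auto simp: K_def R_def)
  show ?thesis
  proof (rule that[OF config_marginal_prob])
    fix j assume j: "j < n"
    have "\<phi> j \<in> borel_measurable borel"
      using \<phi>[of j] by (auto simp: C0_def intro: borel_measurable_continuous_onI)
    then have "(\<integral>x. \<phi> j x \<partial>config_marginal N p) = u j"
      using integral_config_marginal[OF p(1) N] p(3)[OF j] by (simp add: avg_def[abs_def])
    then show "\<bar>(\<integral>x. \<phi> j x \<partial>config_marginal N p) - (\<integral>x. \<phi> j x \<partial>\<rho>)\<bar> < e"
      using coord[of j] j by (simp add: t_def)
  next
    have "transport_cost N (config_marginal N p) \<le> (\<integral>\<^sup>+x. coulomb_cost N x \<partial>measure_pmf p)"
      by (rule transport_cost_config_marginal[OF N])
    also have "\<dots> = (\<integral>\<^sup>+x. ennreal (cr x) \<partial>measure_pmf p)"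
      using p(2) by (intro nn_integral_cong_AE) (auto simp: AE_measure_pmf_iff cr_def)
    also have "\<dots> = ennreal (measure_pmf.expectation p cr)"
      using p(1) by (intro nn_integral_eq_integral integrable_measure_pmf_finite) (auto simp: cr_def)
    also have "\<dots> \<le> ennreal (V + e)"
      using p(4) coord[of n] by (intro ennreal_leI) (auto simp: t_def)
    finally show "transport_cost N (config_marginal N p) \<le> ennreal (V + e)" .
  qed
qed

text \<open>All measures have mass at most 1, so a uniform error in the test function passes to the
  integrals uniformly in \<open>n\<close>. Signed functions are split into positive and negative
  parts.\<close>

lemma weak_star_converges_dense:
  fixes \<Phi> :: "nat \<Rightarrow> real ^ 'd \<Rightarrow> real"
  assumes \<mu>: "\<And>n. \<mu> n \<in> prob_measures" and \<rho>: "\<rho> \<in> subprob_measures" and \<Phi>: "\<And>j. \<Phi> j \<in> C0"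
    and dense: "\<And>\<phi> e. \<phi> \<in> C0 \<Longrightarrow> (\<And>x. \<phi> x \<ge> 0) \<Longrightarrow> e > 0 \<Longrightarrow> \<exists>j. \<forall>x. \<bar>\<phi> x - \<Phi> j x\<bar> \<le> e"
    and lim: "\<And>j. (\<lambda>n. \<integral>x. \<Phi> j x \<partial>\<mu> n) \<longlonglongrightarrow> (\<integral>x. \<Phi> j x \<partial>\<rho>)"
  shows "weak_star_converges \<mu> \<rho>"
proof -
  have int\<mu>: "integrable (\<mu> n) \<phi>" if "\<phi> \<in> C0" for n \<phi>
    using \<mu>[of n] that by (intro C0_integrable) (auto simp: prob_measures_def prob_space_def)
  have int\<rho>: "integrable \<rho> \<phi>" if "\<phi> \<in> C0" for \<phi>
    using \<rho> that by (intro C0_integrable) (auto simp: subprob_measures_def subprob_space_def)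
  have close: "\<bar>(\<integral>x. \<phi> x \<partial>m) - (\<integral>x. \<phi>' x \<partial>m)\<bar> \<le> e"
    if "\<And>x. \<bar>\<phi> x - \<phi>' x\<bar> \<le> e" "integrable m \<phi>" "integrable m \<phi>'" "subprob_space m"
    for m :: "(real ^ 'd) measure" and \<phi> \<phi>' and e :: real
  proof -
    interpret subprob_space m by fact
    have e: "e \<ge> 0" using that(1)[of 0] by linarith
    have "\<bar>(\<integral>x. \<phi> x \<partial>m) - (\<integral>x. \<phi>' x \<partial>m)\<bar> = \<bar>\<integral>x. \<phi> x - \<phi>' x \<partial>m\<bar>"
      using that by simp
    also have "\<dots> \<le> (\<integral>x. \<bar>\<phi> x - \<phi>' x\<bar> \<partial>m)" by (rule integral_abs_bound)
    also have "\<dots> \<le> (\<integral>x. e \<partial>m)" using that by (intro integral_mono) auto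
    also have "\<dots> \<le> e" using e subprob_measure_le_1[of "space m"] by (simp add: mult_left_le_one_le)
    finally show ?thesis .
  qed
  have pos: "(\<lambda>n. \<integral>x. \<phi> x \<partial>\<mu> n) \<longlonglongrightarrow> (\<integral>x. \<phi> x \<partial>\<rho>)" if \<phi>: "\<phi> \<in> C0" "\<And>x. \<phi> x \<ge> 0" for \<phi>
  proof (rule tendstoI)
    fix e :: real assume e: "e > 0"
    obtain j where j: "\<And>x. \<bar>\<phi> x - \<Phi> j x\<bar> \<le> e / 3" using dense[OF \<phi>, of "e/3"] e by auto
    have "\<forall>\<^sub>F n in sequentially. \<bar>(\<integral>x. \<Phi> j x \<partial>\<mu> n) - (\<integral>x. \<Phi> j x \<partial>\<rho>)\<bar> < e / 3"
      using tendstoD[OF lim[of j], of "e/3"] e by (simp add: dist_real_def)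
    then show "\<forall>\<^sub>F n in sequentially. dist (\<integral>x. \<phi> x \<partial>\<mu> n) (\<integral>x. \<phi> x \<partial>\<rho>) < e"
    proof eventually_elim
      case (elim n)
      have "\<bar>(\<integral>x. \<phi> x \<partial>\<mu> n) - (\<integral>x. \<Phi> j x \<partial>\<mu> n)\<bar> \<le> e / 3"
        using j int\<mu>[OF \<phi>(1)] int\<mu>[OF \<Phi>] \<mu>[of n]
        by (intro close) (auto simp: prob_measures_def prob_space_imp_subprob_space)
      moreover have "\<bar>(\<integral>x. \<phi> x \<partial>\<rho>) - (\<integral>x. \<Phi> j x \<partial>\<rho>)\<bar> \<le> e / 3"
        using j int\<rho>[OF \<phi>(1)] int\<rho>[OF \<Phi>] \<rho>
        by (intro close) (auto simp: subprob_measures_def)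
      ultimately show ?case using elim unfolding dist_real_def by linarith
    qed
  qed
  show ?thesis
    unfolding weak_star_converges_def
  proof
    fix \<phi> :: "real ^ 'd \<Rightarrow> real" assume \<phi>: "\<phi> \<in> C0"
    let ?p = "\<lambda>x. max (\<phi> x) 0" and ?m = "\<lambda>x. max (- 1 * \<phi> x) 0"
    have C0: "?p \<in> C0" "?m \<in> C0" using \<phi> by (auto intro!: C0_pos_part C0_cmult[of _ "-1", simplified])
    have eq: "(\<integral>x. \<phi> x \<partial>m) = (\<integral>x. ?p x \<partial>m) - (\<integral>x. ?m x \<partial>m)"
      if "integrable m ?p" "integrable m ?m" for m
      unfolding Bochner_Integration.integral_diff[OF that, symmetric]
      by (intro Bochner_Integration.integral_cong) auto
    show "(\<lambda>n. \<integral>x. \<phi> x \<partial>\<mu> n) \<longlonglongrightarrow> (\<integral>x. \<phi> x \<partial>\<rho>)"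
      unfolding eq[OF int\<mu>[OF C0(1)] int\<mu>[OF C0(2)]] eq[OF int\<rho>[OF C0(1)] int\<rho>[OF C0(2)]]
      using C0 by (intro tendsto_diff pos) auto
  qed
qed

lemma strong_duality:
  fixes \<rho> :: "(real ^ 'd) measure"
  assumes N: "N > 0" and \<rho>: "\<rho> \<in> subprob_measures" and V: "V \<ge> 0"
    and dual: "\<And>\<psi>. \<psi> \<in> class_A N \<Longrightarrow> dual_value \<rho> \<psi> \<le> ereal V"
  shows "relaxed_cost N \<rho> \<le> ennreal V"
proof -
  obtain \<Phi> :: "nat \<Rightarrow> real ^ 'd \<Rightarrow> real" where \<Phi>: "\<And>j. \<Phi> j \<in> C0"
    and dense: "\<And>\<phi> e. \<phi> \<in> C0 \<Longrightarrow> (\<And>x. \<phi> x \<ge> 0) \<Longrightarrow> e > 0 \<Longrightarrow> \<exists>j. \<forall>x. \<bar>\<phi> x - \<Phi> j x\<bar> \<le> e"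
    using C0_pos_separable by blast
  \<comment> \<open>Diagonal choice: the \<open>n\<close>-th measure serves the first
    \<open>n\<close> test functions, so each fixed \<open>\<Phi> j\<close> is served from
    \<open>n = j + 1\<close> on.\<close>
  have "\<exists>\<mu>\<in>prob_measures. (\<forall>j<n. \<bar>(\<integral>x. \<Phi> j x \<partial>\<mu>) - (\<integral>x. \<Phi> j x \<partial>\<rho>)\<bar> < 1 / real (Suc n)) \<and>
      transport_cost N \<mu> \<le> ennreal (V + 1 / real (Suc n))" for n
    using weak_star_approximation[where \<phi> = \<Phi> and e = "1 / real (Suc n)" and n = n, OF N \<rho> \<Phi> V dual]
    by (metis of_nat_0_less_iff zero_less_Suc zero_less_divide_1_iff)
  then obtain \<mu> where \<mu>: "\<And>n. \<mu> n \<in> prob_measures"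
    and approx: "\<And>n j. j < n \<Longrightarrow> \<bar>(\<integral>x. \<Phi> j x \<partial>\<mu> n) - (\<integral>x. \<Phi> j x \<partial>\<rho>)\<bar> < 1 / real (Suc n)"
    and cost: "\<And>n. transport_cost N (\<mu> n) \<le> ennreal (V + 1 / real (Suc n))"
    by metis
  have "(\<lambda>n. \<integral>x. \<Phi> j x \<partial>\<mu> n) \<longlonglongrightarrow> (\<integral>x. \<Phi> j x \<partial>\<rho>)" for j
  proof (rule LIM_zero_cancel, rule Lim_null_comparison)
    show "\<forall>\<^sub>F n in sequentially. norm ((\<integral>x. \<Phi> j x \<partial>\<mu> n) - (\<integral>x. \<Phi> j x \<partial>\<rho>)) \<le> 1 / real (Suc n)"
      using eventually_gt_at_top[of j] by eventually_elim (auto intro: less_imp_le approx simp del: of_nat_Suc)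
    show "(\<lambda>n. 1 / real (Suc n)) \<longlonglongrightarrow> 0" by (intro LIMSEQ_Suc lim_1_over_n)
  qed
  then have "weak_star_converges \<mu> \<rho>" by (intro weak_star_converges_dense[OF \<mu> \<rho> \<Phi> dense])
  then have "relaxed_cost N \<rho> \<le> liminf (\<lambda>n. transport_cost N (\<mu> n))"
    unfolding relaxed_cost_def using \<mu> by (intro INF_lower) auto
  also have "\<dots> \<le> liminf (\<lambda>n. ennreal (V + 1 / real (Suc n)))"
    using cost by (intro Liminf_mono always_eventually) auto
  also have "\<dots> = ennreal V"
  proof (rule lim_imp_Liminf[OF sequentially_bot])
    have "(\<lambda>n. V + 1 / real (Suc n)) \<longlonglongrightarrow> V + 0" by (intro tendsto_intros LIMSEQ_Suc lim_1_over_n)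
    then show "(\<lambda>n. ennreal (V + 1 / real (Suc n))) \<longlonglongrightarrow> ennreal V" by (intro tendsto_ennrealI) simp
  qed
  finally show ?thesis .
qed

subsection \<open>Approximating \<open>class_B\<close> by \<open>class_A\<close>\<close>

lemma class_A_subset_class_B: "class_A N \<subseteq> class_B N"
proof
  fix \<psi> :: "real ^ 'd \<Rightarrow> real" assume "\<psi> \<in> class_A N"
  then obtain \<phi> \<kappa> where \<phi>: "\<phi> \<in> C0" "\<psi> = (\<lambda>x. \<phi> x + \<kappa>)" and below: "below_cost N \<psi>"
    by (auto simp: class_A_def C0_plus_const_def)
  obtain M where M: "\<And>x. \<bar>\<phi> x\<bar> \<le> M" using C0_bounded \<phi>(1) by blast
  have "\<kappa> - M \<le> \<psi> x" for x using M[of x] \<phi>(2) by auto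
  then have "bdd_below (range \<psi>)" by (auto intro!: bdd_belowI2)
  moreover have "lower_semicontinuous \<psi>"
    unfolding lower_semicontinuous_def
  proof
    fix x
    have "continuous_on UNIV \<psi>" using \<phi> by (auto simp: C0_def intro!: continuous_intros)
    then have "(\<psi> \<longlongrightarrow> \<psi> x) (at x)" by (auto simp: continuous_on_def)
    then have "((\<lambda>y. ereal (\<psi> y)) \<longlongrightarrow> ereal (\<psi> x)) (at x)" by (rule tendsto_ereal)
    then show "ereal (\<psi> x) \<le> Liminf (at x) (\<lambda>y. ereal (\<psi> y))"
      by (metis lim_imp_Liminf at_neq_bot order_refl)
  qed
  ultimately show "\<psi> \<in> class_B N" using below by (simp add: class_B_def)
qed

text \<open>The upper bound tests the constraint on a finite-cost configuration translated so that
  its first point is \<open>x\<close>; the other \<open>N - 1\<close> values are bounded below.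
  Translation invariance of the cost makes the bound uniform in \<open>x\<close>.\<close>

lemma below_cost_bounded:
  fixes \<psi> :: "real ^ 'd \<Rightarrow> real"
  assumes "below_cost N \<psi>" "N > 0" "bdd_below (range \<psi>)"
  obtains M where "\<And>x. \<bar>\<psi> x\<bar> \<le> M"
proof -
  obtain m where m: "\<And>x. m \<le> \<psi> x" using assms(3) by (auto simp: bdd_below_def)
  obtain x0 :: "nat \<Rightarrow> real ^ 'd" where x0: "coulomb_cost N x0 < \<top>" "x0 0 = 0" using ex_finite_cost_config .
  let ?c = "enn2real (coulomb_cost N x0)"
  have upper: "\<psi> x \<le> real N * ?c - real (N - 1) * m" for x
  proof -
    have "ereal (1 / real N * (\<Sum>i<N. \<psi> (x + x0 i))) \<le> enn2ereal (coulomb_cost N (\<lambda>i. x + x0 i))"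
      using assms(1) unfolding below_cost_def by (rule spec)
    also have "\<dots> = ereal ?c"
      unfolding coulomb_cost_translate using x0 by (cases "coulomb_cost N x0") (auto simp: enn2ereal_ennreal)
    finally have "(\<Sum>i<N. \<psi> (x + x0 i)) \<le> real N * ?c" using assms(2) by (simp add: field_simps)
    moreover have "(\<Sum>i<N. \<psi> (x + x0 i)) = \<psi> (x + x0 0) + (\<Sum>i\<in>{..<N} - {0}. \<psi> (x + x0 i))"
      using assms(2) by (intro sum.remove) auto
    moreover have "(\<Sum>i\<in>{..<N} - {0}. \<psi> (x + x0 i)) \<ge> real (card ({..<N} - {0})) * m"
      using m by (intro sum_bounded_below) auto
    ultimately show ?thesis using x0 assms(2) by simp
  qed
  have "\<bar>\<psi> x\<bar> \<le> \<bar>m\<bar> + \<bar>real N * ?c - real (N - 1) * m\<bar>" for x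
    using m[of x] upper[of x] by linarith
  then show ?thesis by (rule that)
qed

text \<open>For bounded \<open>g\<close> and \<open>k \<ge> 0\<close> this is the Lipschitz
  regularization, the largest \<open>k\<close>-Lipschitz function below \<open>g\<close>.\<close>

definition inf_convolution :: "real \<Rightarrow> ('a::metric_space \<Rightarrow> real) \<Rightarrow> 'a \<Rightarrow> real" where
  "inf_convolution k g x = (INF y. g y + k * dist x y)"

context
  fixes g :: "'a::metric_space \<Rightarrow> real" and M k :: real
  assumes bound: "\<And>x. \<bar>g x\<bar> \<le> M" and k: "k \<ge> 0"
begin

lemma inf_convolution_lower: "inf_convolution k g x \<le> g y + k * dist x y"
  unfolding inf_convolution_def
proof (rule cINF_lower)
  have "- M \<le> g y + k * dist x y" for y
    using bound[of y] mult_nonneg_nonneg[OF k zero_le_dist[of x y]] unfolding abs_le_iff by linarith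
  then show "bdd_below (range (\<lambda>y. g y + k * dist x y))" by (auto intro!: bdd_belowI2)
qed auto

lemma inf_convolution_greatest:
  "(\<And>y. c \<le> g y + k * dist x y) \<Longrightarrow> c \<le> inf_convolution k g x"
  unfolding inf_convolution_def by (intro cINF_greatest) auto

lemma inf_convolution_le: "inf_convolution k g x \<le> g x"
  using inf_convolution_lower[of x x] by simp

lemma inf_convolution_bounded: "\<bar>inf_convolution k g x\<bar> \<le> M"
proof -
  have "- M \<le> inf_convolution k g x"
  proof (rule inf_convolution_greatest)
    show "- M \<le> g y + k * dist x y" for y
      using bound[of y] mult_nonneg_nonneg[OF k zero_le_dist[of x y]] unfolding abs_le_iff by linarith
  qed
  then show ?thesis using inf_convolution_le[of x] bound[of x] by (simp add: abs_le_iff)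
qed

lemma inf_convolution_continuous: "continuous_on UNIV (inf_convolution k g)"
proof -
  have le: "inf_convolution k g x \<le> inf_convolution k g x' + k * dist x x'" for x x'
  proof -
    have "inf_convolution k g x - k * dist x x' \<le> inf_convolution k g x'"
    proof (rule inf_convolution_greatest)
      fix y
      have "k * dist x y \<le> k * (dist x x' + dist x' y)"
        using k by (intro mult_left_mono dist_triangle) auto
      then show "inf_convolution k g x - k * dist x x' \<le> g y + k * dist x' y"
        using inf_convolution_lower[of x y] by (simp add: algebra_simps)
    qed
    then show ?thesis by simp
  qed
  have "dist (inf_convolution k g x) (inf_convolution k g x') \<le> k * dist x x'" for x x'
    using le[of x x'] le[of x' x] by (simp add: dist_real_def abs_le_iff dist_commute)
  then have "k-lipschitz_on UNIV (inf_convolution k g)" using k by (intro lipschitz_onI) auto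
  then show ?thesis by (rule lipschitz_on_continuous_on)
qed

end

text \<open>For \<open>b\<close> below \<open>g x\<close>, semicontinuity keeps \<open>g\<close>
  above \<open>b\<close> within distance \<open>d\<close> of \<open>x\<close>; farther away the
  penalty eventually exceeds \<open>b + M\<close>, which makes up for
  \<open>g \<ge> - M\<close>.\<close>

lemma inf_convolution_tendsto:
  assumes bound: "\<And>x. \<bar>g x\<bar> \<le> M" and lsc: "ereal (g x) \<le> Liminf (at x) (\<lambda>y. ereal (g y))"
  shows "(\<lambda>n. inf_convolution (real (Suc n)) g x) \<longlonglongrightarrow> g x"
proof (rule order_tendstoI)
  fix a assume a: "a < g x"
  then obtain b where b: "a < b" "b < g x" using dense by blast
  then have "ereal b < Liminf (at x) (\<lambda>y. ereal (g y))"
    using lsc by (intro less_le_trans[OF _ lsc]) simp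
  from less_LiminfD[OF this] have "\<forall>\<^sub>F y in at x. b < g y" by simp
  then obtain d where d: "d > 0" "\<And>y. y \<noteq> x \<Longrightarrow> dist y x < d \<Longrightarrow> b < g y"
    by (auto simp: eventually_at)
  obtain n0 :: nat where n0: "(b + M) / d < real n0" using reals_Archimedean2 by blast
  show "\<forall>\<^sub>F n in sequentially. a < inf_convolution (real (Suc n)) g x"
    using eventually_ge_at_top[of n0]
  proof eventually_elim
    case (elim n)
    have "b \<le> g y + real (Suc n) * dist x y" for y
    proof (cases "dist y x < d")
      case True
      then have "b \<le> g y" using d(2)[of y] b(2) by (cases "y = x") auto
      moreover have "0 \<le> real (Suc n) * dist x y" by simp
      ultimately show ?thesis by linarith
    next
      case False
      have "b + M \<le> real n0 * d" using n0 d(1) by (simp add: field_simps)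
      also have "\<dots> \<le> real (Suc n) * dist x y"
        using elim False d(1) by (intro mult_mono) (auto simp: dist_commute)
      finally show ?thesis using bound[of y] by linarith
    qed
    then have "b \<le> inf_convolution (real (Suc n)) g x"
      by (intro inf_convolution_greatest[where g = g, OF bound]) auto
    then show ?case using b(1) by simp
  qed
next
  fix a assume "g x < a"
  then show "\<forall>\<^sub>F n in sequentially. inf_convolution (real (Suc n)) g x < a"
    by (intro always_eventually allI le_less_trans[OF inf_convolution_le[where g = g, OF bound]]) auto
qed

lemma below_cost_mono:
  assumes "below_cost N \<psi>" "\<And>x. \<psi>' x \<le> \<psi> x"
  shows "below_cost N \<psi>'"
  unfolding below_cost_def
proof
  fix x
  have "ereal (1 / real N * (\<Sum>i<N. \<psi>' (x i))) \<le> ereal (1 / real N * (\<Sum>i<N. \<psi> (x i)))"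
    using assms(2) by (auto intro!: divide_right_mono sum_mono)
  also have "\<dots> \<le> enn2ereal (coulomb_cost N x)" using assms(1) by (simp add: below_cost_def)
  finally show "ereal (1 / real N * (\<Sum>i<N. \<psi>' (x i))) \<le> enn2ereal (coulomb_cost N x)" .
qed

lemma class_B_below_sup_class_A:
  fixes \<psi> :: "real ^ 'd \<Rightarrow> real"
  assumes N: "N > 0" and \<rho>: "\<rho> \<in> subprob_measures" and \<psi>: "\<psi> \<in> class_B N"
    and m: "ereal m < value_at_infinity \<psi>"
  shows "ereal ((\<integral>x. \<psi> x \<partial>\<rho>) + (1 - measure \<rho> UNIV) * m) \<le> (SUP \<psi>\<in>class_A N. dual_value \<rho> \<psi>)"
proof -
  interpret subprob_space \<rho> using \<rho> by (simp add: subprob_measures_def)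
  have sets: "sets \<rho> = sets borel" using \<rho> by (simp add: subprob_measures_def)
  have sp: "space \<rho> = UNIV" using sets_eq_imp_space_eq[OF sets] by simp
  have below: "below_cost N \<psi>" and lsc: "lower_semicontinuous \<psi>" and bdd: "bdd_below (range \<psi>)"
    using \<psi> by (auto simp: class_B_def)
  obtain M where M: "\<And>x. \<bar>\<psi> x\<bar> \<le> M" using below_cost_bounded[OF below N bdd] by blast
  define g where "g = (\<lambda>x. \<psi> x - m)"
  define B where "B = M + \<bar>m\<bar>"
  have B: "\<bar>g x\<bar> \<le> B" for x using M[of x] by (auto simp: g_def B_def)
  have lsc_g: "ereal (g x) \<le> Liminf (at x) (\<lambda>y. ereal (g y))" for x
    unfolding le_Liminf_iff
  proof (intro allI impI)
    fix c assume c: "c < ereal (g x)"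
    have "c + ereal m < ereal (\<psi> x)" using c by (cases c) (auto simp: g_def)
    then have "c + ereal m < Liminf (at x) (\<lambda>y. ereal (\<psi> y))"
      using lsc unfolding lower_semicontinuous_def by (blast intro: less_le_trans)
    from less_LiminfD[OF this]
    show "\<forall>\<^sub>F y in at x. c < ereal (g y)"
      by eventually_elim (cases c; auto simp: g_def)
  qed
  obtain R where R: "\<And>x. norm x \<ge> R \<Longrightarrow> 0 \<le> g x"
  proof -
    have "\<forall>\<^sub>F x in at_infinity. ereal m < ereal (\<psi> x)"
      using less_LiminfD m unfolding value_at_infinity_def by blast
    then show ?thesis using that by (force simp: eventually_at_infinity g_def)
  qed
  \<comment> \<open>The cutoff is 1 up to radius \<open>R + B + real n\<close> and 0 from one unit
    further, so it only acts where \<open>g_far\<close> makes the regularization nonnegative and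
    thus can only decrease it.\<close>
  define h where "h n x = max 0 (min 1 (R + B + real n + 1 - norm x)) * inf_convolution (real (Suc n)) g x" for n x
  \<comment> \<open>The margin \<open>B\<close> is what makes this work: a point \<open>y\<close>
    with \<open>norm y < R\<close> is at distance at least \<open>B\<close> from \<open>x\<close>,
    and slope at least 1 compensates \<open>g y \<ge> - B\<close>.\<close>
  have g_far: "0 \<le> inf_convolution (real (Suc n)) g x" if "norm x \<ge> R + B" for n x
  proof (rule inf_convolution_greatest[where g = g, OF B])
    fix y
    show "0 \<le> g y + real (Suc n) * dist x y"
    proof (cases "norm y \<ge> R")
      case True
      then show ?thesis using R by simp
    next
      case False
      then have "B \<le> dist x y" using that norm_triangle_ineq2[of x y] by (simp add: dist_norm)
      also have "1 * dist x y \<le> real (Suc n) * dist x y" by (intro mult_right_mono) auto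
      finally show ?thesis using B[of y] by linarith
    qed
  qed simp
  have h_le: "h n x \<le> g x" for n x
  proof (cases "norm x \<ge> R + B")
    case True
    have "h n x \<le> 1 * inf_convolution (real (Suc n)) g x"
      unfolding h_def using g_far[OF True] by (intro mult_right_mono) auto
    then show ?thesis using inf_convolution_le[where g = g and k = "real (Suc n)" and x = x, OF B] by simp
  next
    case False
    then show ?thesis using inf_convolution_le[where g = g and k = "real (Suc n)" and x = x, OF B] by (simp add: h_def)
  qed
  have h_bound: "\<bar>h n x\<bar> \<le> B" for n x
  proof -
    have "\<bar>h n x\<bar> \<le> 1 * B"
      unfolding h_def abs_mult using inf_convolution_bounded[where g = g and k = "real (Suc n)" and x = x, OF B]
      by (intro mult_mono) auto
    then show ?thesis by simp
  qed
  have h_C0: "h n \<in> C0" for n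
  proof -
    have "continuous_on UNIV (h n)"
      unfolding h_def by (intro continuous_intros inf_convolution_continuous[where g = g, OF B]) auto
    moreover have "\<forall>\<^sub>F x in at_infinity. h n x = 0"
      unfolding eventually_at_infinity h_def by (intro exI[of _ "R + B + real n + 1"]) auto
    then have "(h n \<longlongrightarrow> 0) at_infinity" by (rule tendsto_eventually)
    ultimately show ?thesis by (simp add: C0_def)
  qed
  have h_lim: "(\<lambda>n. h n x) \<longlonglongrightarrow> g x" for x
  proof -
    obtain n0 :: nat where n0: "norm x - R - B < real n0" using reals_Archimedean2 by blast
    have "\<forall>\<^sub>F n in sequentially. inf_convolution (real (Suc n)) g x = h n x"
      using eventually_ge_at_top[of n0]
    proof eventually_elim
      case (elim n)
      then have "max 0 (min 1 (R + B + real n + 1 - norm x)) = 1" using n0 by auto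
      then show ?case by (simp add: h_def)
    qed
    then show ?thesis by (rule Lim_transform_eventually[OF inf_convolution_tendsto[OF B lsc_g]])
  qed
  have h_meas: "h n \<in> borel_measurable borel" for n
    using h_C0[of n] by (auto simp: C0_def intro: borel_measurable_continuous_onI)
  \<comment> \<open>Borel measurability of \<open>g\<close> is read off from the continuous
    approximants.\<close>
  have g_meas: "g \<in> borel_measurable borel"
    by (rule borel_measurable_LIMSEQ_real[OF h_lim h_meas])
  have "(\<lambda>n. \<integral>x. h n x \<partial>\<rho>) \<longlonglongrightarrow> (\<integral>x. g x \<partial>\<rho>)"
  proof (rule integral_dominated_convergence[where w = "\<lambda>_. B"])
    show "g \<in> borel_measurable \<rho>" "h n \<in> borel_measurable \<rho>" for n
      using g_meas h_meas by (auto simp: measurable_cong_sets[OF sets refl])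
  qed (use h_lim h_bound in auto)
  then have lim: "(\<lambda>n. ereal ((\<integral>x. h n x \<partial>\<rho>) + m)) \<longlonglongrightarrow> ereal ((\<integral>x. g x \<partial>\<rho>) + m)"
    by (intro tendsto_intros)
  have le: "ereal ((\<integral>x. h n x \<partial>\<rho>) + m) \<le> (SUP \<psi>\<in>class_A N. dual_value \<rho> \<psi>)" for n
  proof -
    have "below_cost N (\<lambda>x. h n x + m)"
      using h_le[of n] by (intro below_cost_mono[OF below]) (simp add: g_def algebra_simps)
    then have "(\<lambda>x. h n x + m) \<in> class_A N"
      by (rule class_A_I[OF h_C0])
    then show ?thesis
      unfolding dual_value_C0_plus_const[OF h_C0 \<rho>, symmetric] by (rule SUP_upper)
  qed
  have "ereal ((\<integral>x. g x \<partial>\<rho>) + m) \<le> (SUP \<psi>\<in>class_A N. dual_value \<rho> \<psi>)"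
    by (rule LIMSEQ_le_const2[OF lim]) (use le in blast)
  moreover have "(\<integral>x. g x \<partial>\<rho>) = (\<integral>x. \<psi> x \<partial>\<rho>) - measure \<rho> UNIV * m"
  proof -
    have "\<psi> \<in> borel_measurable borel" using borel_measurable_add[OF g_meas, of "\<lambda>_. m"] by (simp add: g_def)
    then have "integrable \<rho> \<psi>"
      using M by (intro integrable_const_bound[where B = M]) (auto simp: measurable_cong_sets[OF sets refl])
    then show ?thesis unfolding g_def using sp by (subst Bochner_Integration.integral_diff) auto
  qed
  ultimately show ?thesis by (simp add: algebra_simps)
qed

text \<open>Boundedness of \<open>\<psi>\<close> makes its value at infinity a real
  \<open>v\<close>; the strict bound of the preceding lemma is applied at
  \<open>v - 1 / real (Suc n)\<close> and passed to the limit.\<close>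

lemma dual_value_class_B_le:
  assumes N: "N > 0" and \<rho>: "\<rho> \<in> subprob_measures" and \<psi>: "\<psi> \<in> class_B N"
  shows "dual_value \<rho> \<psi> \<le> (SUP \<psi>\<in>class_A N. dual_value \<rho> \<psi>)"
proof -
  have "below_cost N \<psi>" "bdd_below (range \<psi>)" using \<psi> by (auto simp: class_B_def)
  then obtain M where M: "\<And>x. \<bar>\<psi> x\<bar> \<le> M" using below_cost_bounded N by blast
  have "ereal (- M) \<le> ereal (\<psi> x)" "ereal (\<psi> x) \<le> ereal M" for x
    using M[of x] by (auto simp: abs_le_iff)
  then have "ereal (- M) \<le> value_at_infinity \<psi>" "value_at_infinity \<psi> \<le> ereal M"
    unfolding value_at_infinity_def
    by (auto intro!: Liminf_bounded always_eventually Liminf_le simp: trivial_limit_at_infinity)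
  then obtain v where v: "value_at_infinity \<psi> = ereal v" by (cases "value_at_infinity \<psi>") auto
  let ?f = "\<lambda>m. ereal ((\<integral>x. \<psi> x \<partial>\<rho>) + (1 - measure \<rho> UNIV) * m)"
  have lim: "(\<lambda>n. ?f (v - 1 / real (Suc n))) \<longlonglongrightarrow> ?f (v - 0)"
    by (intro tendsto_intros LIMSEQ_Suc lim_1_over_n)
  have le: "?f (v - 1 / real (Suc n)) \<le> (SUP \<psi>\<in>class_A N. dual_value \<rho> \<psi>)" for n
    by (rule class_B_below_sup_class_A[OF N \<rho> \<psi>]) (simp add: v)
  have "?f (v - 0) \<le> (SUP \<psi>\<in>class_A N. dual_value \<rho> \<psi>)"
    by (rule LIMSEQ_le_const2[OF lim]) (use le in blast)
  then show ?thesis by (simp add: dual_value_def v)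
qed

theorem theorem3p2:
  fixes \<rho> :: "(real ^ 'd) measure" and N :: nat
  assumes "N \<ge> 2" and "\<rho> \<in> subprob_measures"
  shows "enn2ereal (relaxed_cost N \<rho>) = (SUP \<psi>\<in>class_A N. dual_value \<rho> \<psi>)
       \<and> (SUP \<psi>\<in>class_A N. dual_value \<rho> \<psi>) = (SUP \<psi>\<in>class_B N. dual_value \<rho> \<psi>)"
proof
  have N: "N > 0" using assms(1) by simp
  let ?S = "SUP \<psi>\<in>class_A N. dual_value \<rho> \<psi>"
  show "enn2ereal (relaxed_cost N \<rho>) = ?S"
  proof (rule antisym)
    \<comment> \<open>Admissibility of 0 makes the supremum nonnegative, which excludes minus
      infinity and gives the \<open>V \<ge> 0\<close> required by
      \<open>strong_duality\<close>.\<close>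
    have C0: "(\<lambda>x :: real ^ 'd. 0) \<in> C0" by (simp add: C0_def)
    then have "(\<lambda>x :: real ^ 'd. 0 + 0) \<in> class_A N"
      by (rule class_A_I) (simp add: below_cost_def zero_ereal_def[symmetric])
    then have "0 \<le> ?S"
      using dual_value_C0_plus_const[OF C0 assms(2), of 0] by (intro SUP_upper2) (auto simp: zero_ereal_def)
    show "enn2ereal (relaxed_cost N \<rho>) \<le> ?S"
    proof (cases ?S)
      case (real V)
      then have "relaxed_cost N \<rho> \<le> ennreal V"
        using \<open>0 \<le> ?S\<close> SUP_upper[of _ "class_A N" "dual_value \<rho>"]
        by (intro strong_duality[OF N assms(2)]) auto
      then have "enn2ereal (relaxed_cost N \<rho>) \<le> enn2ereal (ennreal V)"
        by (simp add: less_eq_ennreal.rep_eq)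
      then show ?thesis using real \<open>0 \<le> ?S\<close> by (simp add: enn2ereal_ennreal)
    qed (use \<open>0 \<le> ?S\<close> in auto)
    show "?S \<le> enn2ereal (relaxed_cost N \<rho>)"
      by (intro SUP_least weak_duality N assms(2))
  qed
  show "?S = (SUP \<psi>\<in>class_B N. dual_value \<rho> \<psi>)"
    using dual_value_class_B_le[OF N assms(2)] class_A_subset_class_B
    by (intro antisym SUP_subset_mono SUP_least) auto
qed

end
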